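(* There exists a subset $S\subset\mathbf R^3$ with $0\in S$ such that $S$ is a 2-dimensional $C^0$ submanifold of $\mathbf R^3$, $S-\{0\}$ is an embedded $C^\infty$ surface (2-dimensional $C^\infty$ submanifold) of $\mathbf R^3$, the pair $(S-\{0\},\{0\})$ satisfies a strict Whitney condition, and $$\lim_{r\to0^+}L(S(0,r)\cap S)=\infty .$$ In particular, a strict Whitney condition does not imply the existence of constants $C$ and $r_0>0$ such that $L(S(0,r)\cap S)\le Cr$ for all $0<r\le r_0$.
   Context: Notation: $S(0,r)$ is the sphere of center $0$ and radius $r$ in $\mathbf R^3$ (not to be confused with the surface $S$); $L(X)$ denotes the length (one-dimensional Hausdorff measure) of a one-dimensional set $X$. Strict Whitney condition for a pair $(M,\{0\})$: let $M$ be a $C^1$ submanifold of $\mathbf R^3$ with $0\in\overline M$, $0\notin M$. For $x\in M$ let $\theta(T_xM,\overline{x0})\in[0,\pi/2]$ be the angle between the line $\overline{x0}$ joining $x$ and $0$ and its orthogonal projection onto the affine tangent space $T_xM$ through $x$, and set $W(x,0)=\sin\theta(T_xM,\overline{x0})$. The pair $(M,\{0\})$ satisfies a strict Whitney condition if there exist an integer $N\ge1$ and a constant $C>0$ such that $W(x,0)^N\le C|x|$ for all $x\in M$. *)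

theory Defs
  imports "HOL-Analysis.Analysis" "HOL-Library.Extended_Nat"
begin

(* C^n regularity; meant for an open set U in a Euclidean space, where continuity of all
   iterated directional derivatives of a differentiable map is the usual C^n condition. *)
primrec Cn_on :: "nat \<Rightarrow> 'a::euclidean_space set \<Rightarrow> ('a \<Rightarrow> 'b::euclidean_space) \<Rightarrow> bool" where
  "Cn_on 0 U f \<longleftrightarrow> continuous_on U f"
| "Cn_on (Suc n) U f \<longleftrightarrow>
     (\<forall>x\<in>U. f differentiable (at x)) \<and> (\<forall>v. Cn_on n U (\<lambda>x. frechet_derivative f (at x) v))"

definition Ck_on :: "enat \<Rightarrow> 'a::euclidean_space set \<Rightarrow> ('a \<Rightarrow> 'b::euclidean_space) \<Rightarrow> bool" where
  "Ck_on k U f \<longleftrightarrow> (\<forall>n. enat n \<le> k \<longrightarrow> Cn_on n U f)"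

(* Embedded submanifolds through ambient charts: near each of its points, M is carried onto a
   piece of a d-dimensional linear subspace by a C^k diffeomorphism between open sets of the
   ambient space (for k = 0 a homeomorphism, so C^0 submanifolds are locally flat). *)
definition Ck_submanifold :: "enat \<Rightarrow> nat \<Rightarrow> 'a::euclidean_space set \<Rightarrow> bool" where
  "Ck_submanifold k d M \<longleftrightarrow>
     (\<forall>p\<in>M. \<exists>U V \<phi> \<psi> (W :: 'a set).
        open U \<and> p \<in> U \<and> open V \<and> homeomorphism U V \<phi> \<psi> \<and> Ck_on k U \<phi> \<and> Ck_on k V \<psi> \<and>
        subspace W \<and> dim W = d \<and> \<phi> ` (U \<inter> M) = V \<inter> W)"

definition tangent_space :: "'a::euclidean_space set \<Rightarrow> 'a \<Rightarrow> 'a set" where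
  "tangent_space M x =
     {v. \<exists>(\<gamma> :: real \<Rightarrow> 'a) \<epsilon>. \<epsilon> > 0 \<and> Ck_on 1 {-\<epsilon><..<\<epsilon>} \<gamma> \<and> \<gamma> ` {-\<epsilon><..<\<epsilon>} \<subseteq> M \<and>
          \<gamma> 0 = x \<and> (\<gamma> has_vector_derivative v) (at 0)}"

definition affine_tangent_space :: "'a::euclidean_space set \<Rightarrow> 'a \<Rightarrow> 'a set" where
  "affine_tangent_space M x = (\<lambda>v. x + v) ` tangent_space M x"

definition orth_proj :: "'a::euclidean_space set \<Rightarrow> 'a \<Rightarrow> 'a" where
  "orth_proj A y = (THE q. q \<in> A \<and> (\<forall>a\<in>A. orthogonal (y - q) (a - q)))"

(* Angle in [0, pi/2] between the lines directed by u and v.  If one of the vectors is 0, the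
   value is arccos 0 = pi/2: this is the intended convention for the angle between a line and
   its projection when the line is orthogonal to the space projected on. *)
definition line_angle :: "'a::euclidean_space \<Rightarrow> 'a \<Rightarrow> real" where
  "line_angle u v = arccos (\<bar>u \<bullet> v\<bar> / (norm u * norm v))"

(* The projection fixes x, so the projected line passes through x and the projection of y. *)
definition tangent_angle :: "'a::euclidean_space set \<Rightarrow> 'a \<Rightarrow> 'a \<Rightarrow> real" where
  "tangent_angle M x y = line_angle (y - x) (orth_proj (affine_tangent_space M x) y - x)"

definition whitney_fun :: "'a::euclidean_space set \<Rightarrow> 'a \<Rightarrow> 'a \<Rightarrow> real" where
  "whitney_fun M x y = sin (tangent_angle M x y)"

definition strict_whitney :: "'a::euclidean_space set \<Rightarrow> bool" where
  "strict_whitney M \<longleftrightarrow>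
     (\<exists>d. Ck_submanifold 1 d M) \<and> 0 \<in> closure M \<and> 0 \<notin> M \<and>
     (\<exists>N::nat. N \<ge> 1 \<and> (\<exists>C>0. \<forall>x\<in>M. whitney_fun M x 0 ^ N \<le> C * norm x))"

(* Coverings use bounded sets only, since diameter is unspecified on unbounded sets. *)
definition hausdorff1_pre :: "real \<Rightarrow> 'a::metric_space set \<Rightarrow> ennreal" where
  "hausdorff1_pre \<delta> X =
     (INF A \<in> {A :: nat \<Rightarrow> 'a set. X \<subseteq> (\<Union>i. A i) \<and> (\<forall>i. bounded (A i) \<and> diameter (A i) \<le> \<delta>)}.
        \<Sum>i. ennreal (diameter (A i)))"

definition hausdorff1 :: "'a::metric_space set \<Rightarrow> ennreal" where
  "hausdorff1 X = (SUP \<delta>\<in>{0<..}. hausdorff1_pre \<delta> X)"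

definition punctured_surface :: "(real^3) set \<Rightarrow> bool" where
  "punctured_surface S \<longleftrightarrow> 0 \<in> S \<and> Ck_submanifold 0 2 S \<and> Ck_submanifold \<infinity> 2 (S - {0})"

end

theory Submission
  imports Defs
begin

text \<open>
  Rotate the plane \<open>z = 0\<close> about the x-axis by an angle \<open>a(p)\<close> that depends only on \<open>x\<close> and
  \<open>q = |p|^2\<close>. Such a twist preserves every sphere around the origin, its inverse is the twist by
  \<open>- a\<close>, and it is a diffeomorphism off the origin as soon as \<open>a\<close> is smooth there. We take
  \<open>a = (\<Sum>k. 4^(-k) f(2 - 2^k q) sin(w k * x^2/q))\<close> with \<open>f\<close> flat: waves of very fast
  growing frequencies \<open>w k\<close> are switched on one after the other as \<open>q\<close> decreases. Since \<open>x^2/q\<close> is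
  constant along rays, the radial derivative of \<open>a\<close> does not see the frequencies and is \<open>O(q)\<close>;
  thus the image of a ray is a curve in the surface whose velocity almost points to the origin,
  which gives the strict Whitney condition. Nothing bounds the frequencies, however, and choosing
  them large enough makes the section with the sphere of radius \<open>r\<close> oscillate so often that
  its length is at least \<open>1 / (96 r^2)\<close>.
\<close>

section \<open>Calculus of C^n maps\<close>

text \<open>Openness of \<open>U\<close> matters: a derivative at a point of \<open>U\<close> then
  depends only on values inside \<open>U\<close>, so the functions may differ elsewhere.\<close>

lemma Cn_on_cong:
  assumes "open U" "\<And>x. x \<in> U \<Longrightarrow> f x = g x"
  shows "Cn_on n U f \<longleftrightarrow> Cn_on n U g"
  using assms(2)
proof (induction n arbitrary: f g)
  case 0
  then show ?case by (simp cong: continuous_on_cong)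
next
  case (Suc n)
  have der: "(f has_derivative D) (at x) \<longleftrightarrow> (g has_derivative D) (at x)" if "x \<in> U" for x D
    using has_derivative_transform_within_open[OF _ assms(1) that, of f D UNIV g]
      has_derivative_transform_within_open[OF _ assms(1) that, of g D UNIV f] Suc.prems by auto
  have "frechet_derivative f (at x) = frechet_derivative g (at x)" if "x \<in> U" for x
    unfolding frechet_derivative_def using der[OF that] by simp
  then have "Cn_on n U (\<lambda>x. frechet_derivative f (at x) v) \<longleftrightarrow>
      Cn_on n U (\<lambda>x. frechet_derivative g (at x) v)" for v
    by (intro Suc.IH) simp
  moreover have "f differentiable (at x) \<longleftrightarrow> g differentiable (at x)" if "x \<in> U" for x
    unfolding differentiable_def using der[OF that] by simp
  ultimately show ?case by simp
qed

text \<open>Lets an explicit derivative \<open>D\<close> stand in for the one selected by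
  \<open>frechet_derivative\<close>; uniqueness of derivatives identifies the two.\<close>

lemma Cn_on_SucI:
  assumes "open U" "\<And>x. x \<in> U \<Longrightarrow> (f has_derivative D x) (at x)"
    "\<And>v. Cn_on n U (\<lambda>x. D x v)"
  shows "Cn_on (Suc n) U f"
proof -
  have "Cn_on n U (\<lambda>x. frechet_derivative f (at x) v)" for v
    using assms(3)[of v] Cn_on_cong[OF assms(1), of "\<lambda>x. frechet_derivative f (at x) v" "\<lambda>x. D x v" n]
      frechet_derivative_at[OF assms(2)] by simp
  then show ?thesis
    using assms(2) by (auto simp: differentiable_def)
qed

lemma Cn_on_SucD:
  assumes "Cn_on (Suc n) U f"
  shows "x \<in> U \<Longrightarrow> (f has_derivative frechet_derivative f (at x)) (at x)"
    and "Cn_on n U (\<lambda>x. frechet_derivative f (at x) v)"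
  using assms by (simp_all add: frechet_derivative_works)

lemma Cn_on_Suc_D: "Cn_on (Suc n) U f \<Longrightarrow> Cn_on n U f"
proof (induction n arbitrary: f)
  case 0
  then show ?case
    by (auto intro!: continuous_at_imp_continuous_on differentiable_imp_continuous_within)
next
  case (Suc n)
  then show ?case by (metis Cn_on.simps(2))
qed

text \<open>Needed for the rotation angle, which is a finite sum of waves only locally: more and
  more waves are active towards the origin.\<close>

lemma Cn_on_local:
  assumes "\<And>x. x \<in> U \<Longrightarrow> \<exists>V. open V \<and> x \<in> V \<and> Cn_on n V f"
  shows "Cn_on n U f"
  using assms
proof (induction n arbitrary: f)
  case 0
  then show ?case
    unfolding Cn_on.simps by (meson continuous_at_imp_continuous_on continuous_on_eq_continuous_at)
next
  case (Suc n)
  have "\<exists>V. open V \<and> x \<in> V \<and> Cn_on n V (\<lambda>x. frechet_derivative f (at x) v)" if "x \<in> U" for x v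
    using Suc.prems[OF that] by auto
  then have "Cn_on n U (\<lambda>x. frechet_derivative f (at x) v)" for v
    by (rule Suc.IH)
  then show ?case using Suc.prems by auto
qed

lemma Cn_on_const: "Cn_on n U (\<lambda>x. c)"
  by (induction n arbitrary: c) auto

lemma Cn_on_bounded_linear:
  assumes "open U" "bounded_linear f"
  shows "Cn_on n U f"
proof (cases n)
  case 0
  then show ?thesis using assms(2) by (simp add: linear_continuous_on)
next
  case (Suc m)
  have "Cn_on (Suc m) U f"
    by (rule Cn_on_SucI[where D = "\<lambda>_. f"])
      (use assms in \<open>auto intro: bounded_linear_imp_has_derivative Cn_on_const\<close>)
  then show ?thesis by (simp add: Suc)
qed

lemma Cn_on_add:
  assumes "open U" "Cn_on n U f" "Cn_on n U g"
  shows "Cn_on n U (\<lambda>x. f x + g x)"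
  using assms(2,3)
proof (induction n arbitrary: f g)
  case 0
  then show ?case by (auto intro: continuous_on_add)
next
  case (Suc n)
  define D where "D x = frechet_derivative f (at x)" for x
  note D = Cn_on_SucD[OF Suc.prems(1), folded D_def]
  define E where "E x = frechet_derivative g (at x)" for x
  note E = Cn_on_SucD[OF Suc.prems(2), folded E_def]
  show ?case
  proof (rule Cn_on_SucI[OF assms(1)])
    show "((\<lambda>x. f x + g x) has_derivative (\<lambda>v. D x v + E x v)) (at x)" if "x \<in> U" for x
      using D(1)[OF that] E(1)[OF that] by (rule has_derivative_add)
    show "Cn_on n U (\<lambda>x. D x v + E x v)" for v
      using D(2) E(2) by (rule Suc.IH)
  qed
qed

lemma Cn_on_sum:
  assumes "open U" "\<And>i. i \<in> I \<Longrightarrow> Cn_on n U (f i)"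
  shows "Cn_on n U (\<lambda>x. \<Sum>i\<in>I. f i x)"
  using assms(2)
proof (induction I rule: infinite_finite_induct)
  case (insert i I)
  then have "Cn_on n U (\<lambda>x. f i x + (\<Sum>i\<in>I. f i x))"
    by (intro Cn_on_add[OF assms(1)]) auto
  then show ?case using insert by simp
qed (simp_all add: Cn_on_const)

lemma Cn_on_bilinear:
  assumes "bounded_bilinear pr" "open U" "Cn_on n U f" "Cn_on n U g"
  shows "Cn_on n U (\<lambda>x. pr (f x) (g x))"
  using assms(3,4)
proof (induction n arbitrary: f g)
  case 0
  then show ?case by (auto intro: bounded_bilinear.continuous_on[OF assms(1)])
next
  case (Suc n)
  define D where "D x = frechet_derivative f (at x)" for x
  note D = Cn_on_SucD[OF Suc.prems(1), folded D_def]
  define E where "E x = frechet_derivative g (at x)" for x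
  note E = Cn_on_SucD[OF Suc.prems(2), folded E_def]
  show ?case
  proof (rule Cn_on_SucI[OF assms(2)])
    show "((\<lambda>x. pr (f x) (g x)) has_derivative (\<lambda>v. pr (f x) (E x v) + pr (D x v) (g x))) (at x)"
      if "x \<in> U" for x
      using bounded_bilinear.FDERIV[OF assms(1) D(1)[OF that] E(1)[OF that]] .
    show "Cn_on n U (\<lambda>x. pr (f x) (E x v) + pr (D x v) (g x))" for v
      using Suc.IH[OF Cn_on_Suc_D[OF Suc.prems(1)] E(2)] Suc.IH[OF D(2) Cn_on_Suc_D[OF Suc.prems(2)]]
      by (rule Cn_on_add[OF assms(2)])
  qed
qed

lemmas Cn_on_scaleR = Cn_on_bilinear[OF bounded_bilinear_scaleR]
lemmas Cn_on_mult = Cn_on_bilinear[OF bounded_bilinear_mult]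
lemmas Cn_on_inner = Cn_on_bilinear[OF bounded_bilinear_inner]

text \<open>
  Expanding \<open>D f (g x) (D g x v)\<close> in the basis turns the derivative of \<open>f \<circ> g\<close> into a sum of
  products of compositions with the partial derivatives of \<open>f\<close>, to which the induction hypothesis
  applies.
\<close>
lemma Cn_on_compose:
  assumes "open U" "open V" "g ` U \<subseteq> V" "Cn_on n V f" "Cn_on n U g"
  shows "Cn_on n U (\<lambda>x. f (g x))"
  using assms(4,5)
proof (induction n arbitrary: f)
  case 0
  then show ?case using continuous_on_compose2[of V f U g] assms(3) by simp
next
  case (Suc n)
  define D where "D x = frechet_derivative f (at x)" for x
  note D = Cn_on_SucD[OF Suc.prems(1), folded D_def]
  define E where "E x = frechet_derivative g (at x)" for x
  note E = Cn_on_SucD[OF Suc.prems(2), folded E_def]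
  have comp: "(\<Sum>b\<in>Basis. (E x v \<bullet> b) *\<^sub>R D (g x) b) = D (g x) (E x v)" if "x \<in> U" for x v
  proof -
    have "linear (D (g x))"
      using D(1)[of "g x"] that assms(3) by (auto intro: has_derivative_linear)
    then have "D (g x) (\<Sum>b\<in>Basis. (E x v \<bullet> b) *\<^sub>R b) = (\<Sum>b\<in>Basis. (E x v \<bullet> b) *\<^sub>R D (g x) b)"
      by (simp add: linear_sum linear_cmul)
    then show ?thesis by (simp add: euclidean_representation)
  qed
  show ?case
  proof (rule Cn_on_SucI[OF assms(1)])
    show "((\<lambda>x. f (g x)) has_derivative (\<lambda>v. D (g x) (E x v))) (at x)" if "x \<in> U" for x
      using has_derivative_compose[OF E(1)[OF that]] D(1)[of "g x"] that assms(3) by blast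
    show "Cn_on n U (\<lambda>x. D (g x) (E x v))" for v
    proof -
      have "Cn_on n U (\<lambda>x. \<Sum>b\<in>Basis. (E x v \<bullet> b) *\<^sub>R D (g x) b)"
        using D(2) E(2) Cn_on_Suc_D[OF Suc.prems(2)]
        by (intro Cn_on_sum Cn_on_scaleR Cn_on_inner Suc.IH Cn_on_const assms(1))
      also have "?this \<longleftrightarrow> ?thesis"
        by (rule Cn_on_cong[OF assms(1)]) (rule comp)
      finally show ?thesis .
    qed
  qed
qed

lemma Cn_on_Suc_realI:
  fixes f :: "real \<Rightarrow> real"
  assumes "open U" "\<And>x. x \<in> U \<Longrightarrow> (f has_real_derivative f' x) (at x)" "Cn_on n U f'"
  shows "Cn_on (Suc n) U f"
  by (rule Cn_on_SucI[OF assms(1), where D = "\<lambda>x v. f' x * v"])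
    (use assms in \<open>auto simp: has_field_derivative_def intro: Cn_on_mult Cn_on_const\<close>)

text \<open>A joint induction, because each function is up to sign the derivative of the
  other.\<close>

lemma Cn_on_sin_cos: "Cn_on n UNIV (sin :: real \<Rightarrow> real) \<and> Cn_on n UNIV (cos :: real \<Rightarrow> real)"
proof (induction n)
  case 0
  then show ?case by (auto intro: continuous_intros)
next
  case (Suc n)
  have "Cn_on n UNIV (\<lambda>x::real. (-1) * sin x)"
    using Suc by (intro Cn_on_mult Cn_on_const) auto
  then have "Cn_on (Suc n) UNIV (cos :: real \<Rightarrow> real)"
    by (intro Cn_on_Suc_realI[where f' = "\<lambda>x. (-1) * sin x"]) (auto intro!: derivative_eq_intros)
  moreover have "Cn_on (Suc n) UNIV (sin :: real \<Rightarrow> real)"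
    using Suc by (intro Cn_on_Suc_realI[where f' = cos]) (auto intro!: derivative_eq_intros)
  ultimately show ?case by blast
qed

lemma Cn_on_inverse: "Cn_on n (- {0}) (inverse :: real \<Rightarrow> real)"
proof (induction n)
  case 0
  then show ?case by (auto intro!: continuous_on_inverse continuous_on_id)
next
  case (Suc n)
  have "Cn_on n (- {0}) (\<lambda>x::real. (-1) * (inverse x * inverse x))"
    using Suc by (intro Cn_on_mult Cn_on_const) auto
  then show ?case
    by (intro Cn_on_Suc_realI[where f' = "\<lambda>x. (-1) * (inverse x * inverse x)"])
      (auto intro!: derivative_eq_intros simp del: Cn_on.simps)
qed

section \<open>A flat function\<close>

text \<open>\<open>flat 0\<close> is the classical flat function. The divisions by
  \<open>t ^ n\<close> are included because the linear span of the family is then closed under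
  differentiation, so smoothness follows by one induction.\<close>

definition flat :: "nat \<Rightarrow> real \<Rightarrow> real" where
  "flat n t = (if t > 0 then exp (- 1 / t) / t ^ n else 0)"

lemma flat_nonneg: "flat n t \<ge> 0"
  by (simp add: flat_def)

text \<open>The exponential series of \<open>1 / t\<close> dominates its single term of index
  \<open>n + m\<close>.\<close>

lemma flat_le:
  assumes "t > 0"
  shows "flat n t \<le> fact (n + m) * t ^ m"
proof -
  have "(\<Sum>k\<in>{n + m}. (1 / t) ^ k /\<^sub>R fact k) \<le> (\<Sum>k. (1 / t) ^ k /\<^sub>R fact k)"
    using assms by (intro sum_le_suminf summable_exp_generic) auto
  then have "(1 / t) ^ (n + m) / fact (n + m) \<le> exp (1 / t)"
    by (simp add: exp_def divide_inverse mult.commute)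
  then have "1 \<le> fact (n + m) * t ^ (n + m) * exp (1 / t)"
    using assms by (simp add: power_divide field_simps)
  then show ?thesis
    using assms by (simp add: flat_def exp_minus power_add field_simps)
qed

lemma abs_flat_le: "\<bar>flat n t\<bar> \<le> fact (n + m) * \<bar>t\<bar> ^ m"
  using flat_le[of t n m] by (cases "t > 0") (auto simp: flat_def)

lemma has_real_derivative_flat:
  "(flat n has_real_derivative (flat (n + 2) t - real n * flat (n + 1) t)) (at t)"
proof -
  consider "t > 0" | "t < 0" | "t = 0" by linarith
  then show ?thesis
  proof cases
    case 1
    have pw: "real n * t ^ (n - Suc 0) = real n * t ^ n / t"
      using 1 by (cases n) auto
    have "((\<lambda>t. exp (- 1 / t) / t ^ n) has_real_derivative
        (exp (- 1 / t) / t\<^sup>2 * t ^ n - exp (- 1 / t) * (real n * t ^ n / t)) / (t ^ n * t ^ n)) (at t)"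
      using 1 by (auto intro!: derivative_eq_intros simp: pw power2_eq_square)
    also have "(exp (- 1 / t) / t\<^sup>2 * t ^ n - exp (- 1 / t) * (real n * t ^ n / t)) / (t ^ n * t ^ n) =
        flat (n + 2) t - real n * flat (n + 1) t"
      using 1 by (simp add: flat_def power_add power2_eq_square field_simps)
    finally have "((\<lambda>t. exp (- 1 / t) / t ^ n) has_real_derivative
        (flat (n + 2) t - real n * flat (n + 1) t)) (at t)" .
    then show ?thesis
      by (rule has_field_derivative_transform_within_open[where S = "{0<..}"])
        (use 1 in \<open>auto simp: flat_def\<close>)
  next
    case 2
    have "((\<lambda>t. 0) has_real_derivative (flat (n + 2) t - real n * flat (n + 1) t)) (at t)"
      using 2 by (simp add: flat_def)
    then show ?thesis
      by (rule has_field_derivative_transform_within_open[where S = "{..<0}"])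
        (use 2 in \<open>auto simp: flat_def\<close>)
  next
    case 3
    \<comment> \<open>At 0 the difference quotient is at most a constant times
      \<open>\<bar>h\<bar>\<close>, by the quadratic case of \<open>abs_flat_le\<close>.\<close>
    have "((\<lambda>h. (flat n (0 + h) - flat n 0) / h) \<longlongrightarrow> 0) (at 0)"
    proof (rule Lim_null_comparison)
      define K :: real where "K = fact (n + 2)"
      have "\<bar>flat n h\<bar> / \<bar>h\<bar> \<le> K * \<bar>h\<bar>" if "h \<noteq> 0" for h
        using abs_flat_le[of n h 2, folded K_def] that
        by (simp add: divide_le_eq power2_eq_square mult.assoc)
      then show "\<forall>\<^sub>F h in at 0. norm ((flat n (0 + h) - flat n 0) / h) \<le> fact (n + 2) * \<bar>h\<bar>"
        by (auto simp: flat_def[of n 0] eventually_at_filter K_def)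
      show "((\<lambda>h::real. fact (n + 2) * \<bar>h\<bar>) \<longlongrightarrow> 0) (at 0)"
        by (auto intro!: tendsto_eq_intros)
    qed
    then show ?thesis
      using 3 by (simp add: DERIV_def flat_def)
  qed
qed

lemma Cn_on_flat: "Cn_on m UNIV (flat n)"
proof (induction m arbitrary: n)
  case 0
  then show ?case
    by (auto intro!: continuous_at_imp_continuous_on DERIV_isCont has_real_derivative_flat)
next
  case (Suc m)
  have "Cn_on m UNIV (\<lambda>t. flat (n + 2) t + (- real n) * flat (n + 1) t)"
    using Suc by (intro Cn_on_add Cn_on_mult Cn_on_const) auto
  then show ?case
    by (intro Cn_on_Suc_realI[where f' = "\<lambda>t. flat (n + 2) t + (- real n) * flat (n + 1) t"])
      (use has_real_derivative_flat in \<open>auto simp del: Cn_on.simps\<close>)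
qed

section \<open>A lower bound for length\<close>

text \<open>
  A member of a covering with diameters at most \<open>\<delta>\<close> contains at most one of the \<open>n\<close> points at a given
  height, so the intervals of radius \<open>diameter (A i)\<close> around one height \<open>p (a i)\<close> attained on \<open>A i\<close>
  cover \<open>{-h..h}\<close> at least \<open>n\<close> times.
\<close>
lemma hausdorff1_pre_ge:
  fixes p :: "'a::metric_space \<Rightarrow> real" and n :: nat and h :: real
  assumes lip: "\<And>x y. \<bar>p x - p y\<bar> \<le> dist x y"
    and pts: "\<And>y. y \<in> {-h..h} \<Longrightarrow>
      \<exists>t :: nat \<Rightarrow> 'a. \<forall>i<n. t i \<in> X \<and> p (t i) = y \<and> (\<forall>j<i. dist (t j) (t i) > \<delta>)"
  shows "hausdorff1_pre \<delta> X \<ge> ennreal (n * h)"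
  unfolding hausdorff1_pre_def
proof (rule INF_greatest)
  fix A assume "A \<in> {A :: nat \<Rightarrow> 'a set. X \<subseteq> (\<Union>i. A i) \<and> (\<forall>i. bounded (A i) \<and> diameter (A i) \<le> \<delta>)}"
  then have A: "X \<subseteq> (\<Union>i. A i)" "\<And>i. bounded (A i)" "\<And>i. diameter (A i) \<le> \<delta>" by auto
  \<comment> \<open>For empty \<open>A i\<close> the choice is arbitrary, which is harmless:
    \<open>mem\<close> says nothing about such a set.\<close>
  define a where "a i = (SOME x. x \<in> A i)" for i
  define I where "I i = {p (a i) - diameter (A i) .. p (a i) + diameter (A i)}" for i
  have mem: "p x \<in> I i" if "x \<in> A i" for x i
  proof -
    have "a i \<in> A i" unfolding a_def using that by (rule someI)
    then have "dist x (a i) \<le> diameter (A i)"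
      using that by (intro diameter_bounded_bound A)
    then show ?thesis using lip[of x "a i"] by (auto simp: I_def)
  qed
  have count: "ennreal n * indicator {-h..h} y \<le> (\<Sum>i. indicator (I i) y)" for y
  proof (cases "y \<in> {-h..h}")
    case True
    obtain t where "\<forall>i<n. t i \<in> X \<and> p (t i) = y \<and> (\<forall>j<i. dist (t j) (t i) > \<delta>)"
      using pts[OF True] by (rule exE)
    then have t: "\<And>i. i < n \<Longrightarrow> t i \<in> X" "\<And>i. i < n \<Longrightarrow> p (t i) = y"
      "\<And>i j. i < n \<Longrightarrow> j < i \<Longrightarrow> dist (t j) (t i) > \<delta>"
      by auto
    have "\<exists>k. t i \<in> A k" if "i < n" for i using t(1)[OF that] A(1) by blast
    then obtain k where k: "\<And>i. i < n \<Longrightarrow> t i \<in> A (k i)" by metis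
    have "k i \<noteq> k j" if "i < n" "j < i" for i j
    proof
      assume "k i = k j"
      then have "dist (t j) (t i) \<le> diameter (A (k i))"
        using k[of i] k[of j] that by (intro diameter_bounded_bound A) auto
      then show False using A(3)[of "k i"] t(3)[OF that] by linarith
    qed
    then have "inj_on k {..<n}"
      by (intro inj_onI) (metis lessThan_iff linorder_neqE_nat)
    then have "ennreal n = (\<Sum>i\<in>k ` {..<n}. 1)"
      by (simp add: card_image ennreal_of_nat_eq_real_of_nat)
    also have "\<dots> = (\<Sum>i\<in>k ` {..<n}. indicator (I i) y)"
      using mem[OF k] t(2) by (intro sum.cong) auto
    also have "\<dots> \<le> (\<Sum>i. indicator (I i) y)"
      by (intro sum_le_suminf) auto
    finally show ?thesis using True by simp
  qed simp
  \<comment> \<open>Integrate \<open>count\<close>. The interval of heights has length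
    \<open>2 * h\<close> (for negative \<open>h\<close>, \<open>ennreal\<close> makes this 0) and
    \<open>I i\<close> has length \<open>2 * diameter (A i)\<close>, so the factor 2 cancels at the
    end.\<close>
  have "ennreal n * ennreal (2 * h) \<le> ennreal n * emeasure lborel {-h..h}"
    by (cases "h \<ge> 0") (auto simp: ennreal_neg)
  also have "\<dots> = (\<integral>\<^sup>+ y. ennreal n * indicator {-h..h} y \<partial>lborel)"
    by (simp add: nn_integral_cmult_indicator)
  also have "\<dots> \<le> (\<integral>\<^sup>+ y. (\<Sum>i. indicator (I i) y) \<partial>lborel)"
    by (intro nn_integral_mono count)
  also have "\<dots> = (\<Sum>i. \<integral>\<^sup>+ y. indicator (I i) y \<partial>lborel)"
    by (intro nn_integral_suminf) (auto simp: I_def)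
  also have "\<dots> = (\<Sum>i. 2 * ennreal (diameter (A i)))"
  proof (rule suminf_cong)
    fix i
    have "diameter (A i) \<ge> 0" by (intro diameter_ge_0 A)
    then have "(\<integral>\<^sup>+ y. indicator (I i) y \<partial>lborel) = ennreal (2 * diameter (A i))"
      by (simp add: I_def)
    also have "\<dots> = 2 * ennreal (diameter (A i))"
      using ennreal_mult'[of 2 "diameter (A i)"] by simp
    finally show "(\<integral>\<^sup>+ y. indicator (I i) y \<partial>lborel) = 2 * ennreal (diameter (A i))" .
  qed
  also have "\<dots> = 2 * (\<Sum>i. ennreal (diameter (A i)))"
    by simp
  also have "ennreal n * ennreal (2 * h) = ennreal (2 * (n * h))"
    using ennreal_mult''[of "real n" "2 * h"] by (simp add: ac_simps)
  also have "\<dots> = 2 * ennreal (n * h)"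
    using ennreal_mult'[of 2 "n * h"] by simp
  finally have "2 * ennreal (n * h) \<le> 2 * (\<Sum>i. ennreal (diameter (A i)))" .
  then show "ennreal (n * h) \<le> (\<Sum>i. ennreal (diameter (A i)))"
    by (subst (asm) ennreal_mult_le_mult_iff) auto
qed

lemma hausdorff1_pre_le_hausdorff1: "\<delta> > 0 \<Longrightarrow> hausdorff1_pre \<delta> X \<le> hausdorff1 X"
  unfolding hausdorff1_def by (intro SUP_upper) simp

section \<open>Tangent spaces and the Whitney function\<close>

lemma Ck_submanifold_mono:
  fixes M :: "'a::euclidean_space set"
  shows "Ck_submanifold k d M \<Longrightarrow> l \<le> k \<Longrightarrow> Ck_submanifold l d M"
proof -
  assume M: "Ck_submanifold k d M" and "l \<le> k"
  then have ck: "Ck_on k U f \<Longrightarrow> Ck_on l U f" for U and f :: "'a \<Rightarrow> 'a"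
    unfolding Ck_on_def by (blast intro: order_trans)
  show ?thesis
    unfolding Ck_submanifold_def
  proof
    fix p assume "p \<in> M"
    then obtain U V \<phi> \<psi> and W :: "'a set" where "open U \<and> p \<in> U \<and> open V \<and> homeomorphism U V \<phi> \<psi> \<and>
        Ck_on k U \<phi> \<and> Ck_on k V \<psi> \<and> subspace W \<and> dim W = d \<and> \<phi> ` (U \<inter> M) = V \<inter> W"
      using M unfolding Ck_submanifold_def by (elim ballE exE) blast+
    then show "\<exists>U V \<phi> \<psi> (W :: 'a set). open U \<and> p \<in> U \<and> open V \<and> homeomorphism U V \<phi> \<psi> \<and>
        Ck_on l U \<phi> \<and> Ck_on l V \<psi> \<and> subspace W \<and> dim W = d \<and> \<phi> ` (U \<inter> M) = V \<inter> W"
      using ck by (intro exI[of _ U] exI[of _ V] exI[of _ \<phi>] exI[of _ \<psi>] exI[of _ W]) auto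
  qed
qed

text \<open>Near 0 the difference quotients lie in \<open>W\<close>, and a subspace of a Euclidean
  space is closed.\<close>

lemma differentiable_curve_in_subspace:
  fixes c :: "real \<Rightarrow> 'a::euclidean_space"
  assumes "subspace W" "(c has_vector_derivative v) (at 0)" "\<forall>\<^sub>F t in at 0. c t \<in> W" "c 0 \<in> W"
  shows "v \<in> W"
proof (rule Lim_in_closed_set)
  show "closed W" using assms(1) by (rule closed_subspace)
  show "\<forall>\<^sub>F t in at 0. (c (0 + t) - c 0) /\<^sub>R t \<in> W"
    using assms(3) by eventually_elim (use assms(1,4) in \<open>auto intro: subspace_scale subspace_diff\<close>)
  show "((\<lambda>t. (c (0 + t) - c 0) /\<^sub>R t) \<longlongrightarrow> v) (at 0)"
  proof -
    have "((\<lambda>t. norm (c (0 + t) - c 0 - t *\<^sub>R v) / norm t) \<longlongrightarrow> 0) (at 0)"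
      using assms(2) unfolding has_vector_derivative_def has_derivative_at by simp
    moreover have "\<forall>\<^sub>F t in at 0. norm (c (0 + t) - c 0 - t *\<^sub>R v) / norm t =
        norm ((c (0 + t) - c 0) /\<^sub>R t - v)"
      unfolding eventually_at_filter
    proof (intro always_eventually allI impI)
      fix t :: real assume "t \<noteq> 0"
      then have "(c (0 + t) - c 0) /\<^sub>R t - v = (c (0 + t) - c 0 - t *\<^sub>R v) /\<^sub>R t"
        by (simp add: scaleR_diff_right)
      then show "norm (c (0 + t) - c 0 - t *\<^sub>R v) / norm t = norm ((c (0 + t) - c 0) /\<^sub>R t - v)"
        by (simp add: divide_inverse mult.commute)
    qed
    ultimately have "((\<lambda>t. norm ((c (0 + t) - c 0) /\<^sub>R t - v)) \<longlongrightarrow> 0) (at 0)"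
      by (rule Lim_transform_eventually)
    then show ?thesis using tendsto_norm_zero_iff LIM_zero_iff by blast
  qed
qed auto

text \<open>With tangent vectors defined as velocities of curves, closure under addition is not
  evident. A chart identifies the tangent space with the preimage of \<open>W\<close> under the
  derivative \<open>D\<close> of the chart.\<close>

lemma subspace_tangent_space:
  fixes M :: "'a::euclidean_space set"
  assumes "Ck_submanifold k d M" "1 \<le> k" "x \<in> M"
  shows "subspace (tangent_space M x)"
proof -
  have "Ck_submanifold 1 d M" using assms(1,2) by (rule Ck_submanifold_mono)
  then obtain U V \<phi> \<psi> and W :: "'a set" where U: "open U" "x \<in> U" and V: "open V"
    and hom: "homeomorphism U V \<phi> \<psi>" and ck: "Ck_on 1 U \<phi>" "Ck_on 1 V \<psi>"
    and W: "subspace W" and im: "\<phi> ` (U \<inter> M) = V \<inter> W"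
    using assms(3) unfolding Ck_submanifold_def by (elim ballE exE conjE) blast+
  define D where "D = frechet_derivative \<phi> (at x)"
  define E where "E = frechet_derivative \<psi> (at (\<phi> x))"
  have c1: "Cn_on (Suc 0) U \<phi>" "Cn_on (Suc 0) V \<psi>"
    using ck by (auto simp: Ck_on_def one_enat_def simp del: Cn_on.simps)
  have \<phi>x: "\<phi> x \<in> V" "\<phi> x \<in> W" using im U assms(3) by blast+
  have inv: "\<And>y. y \<in> U \<Longrightarrow> \<psi> (\<phi> y) = y" "\<And>z. z \<in> V \<Longrightarrow> \<phi> (\<psi> z) = z" "\<And>z. z \<in> V \<Longrightarrow> \<psi> z \<in> U"
    using hom by (auto simp: homeomorphism_def)
  have D: "(\<phi> has_derivative D) (at x)"
    using Cn_on_SucD(1)[OF c1(1) U(2)] by (simp add: D_def)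
  have E: "(\<psi> has_derivative E) (at (\<phi> x))"
    using Cn_on_SucD(1)[OF c1(2) \<phi>x(1)] by (simp add: E_def)
  have ED: "E (D v) = v" for v
  proof -
    have "((\<lambda>y. \<psi> (\<phi> y)) has_derivative (\<lambda>v. E (D v))) (at x)"
      using has_derivative_compose[OF D E] .
    moreover have "((\<lambda>y. \<psi> (\<phi> y)) has_derivative (\<lambda>v. v)) (at x)"
      by (rule has_derivative_transform_within_open[OF has_derivative_ident U]) (simp add: inv)
    ultimately show ?thesis by (metis has_derivative_unique)
  qed
  have "tangent_space M x = {v. D v \<in> W}"
  proof (intro equalityI subsetI CollectI)
    fix v assume "v \<in> tangent_space M x"
    then obtain \<gamma> :: "real \<Rightarrow> 'a" and \<epsilon> where g: "\<epsilon> > 0" "\<gamma> ` {-\<epsilon><..<\<epsilon>} \<subseteq> M" "\<gamma> 0 = x"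
      "(\<gamma> has_vector_derivative v) (at 0)"
      unfolding tangent_space_def by blast
    show "D v \<in> W"
    proof (rule differentiable_curve_in_subspace[OF W])
      show "((\<lambda>t. \<phi> (\<gamma> t)) has_vector_derivative D v) (at 0)"
        using vector_derivative_diff_chain_within[of \<gamma> v 0 UNIV \<phi> D] g(3,4) D
        by (simp add: o_def has_derivative_at_withinI)
      have "isCont \<gamma> 0" using g(4) by (rule has_vector_derivative_continuous)
      then have "\<forall>\<^sub>F t in at 0. \<gamma> t \<in> U"
        using U g(3) by (auto simp: isCont_def elim!: topological_tendstoD)
      moreover have "\<forall>\<^sub>F t in at 0. t \<in> {-\<epsilon><..<\<epsilon>}"
        by (rule eventually_at_in_open') (use g(1) in auto)
      ultimately show "\<forall>\<^sub>F t in at 0. \<phi> (\<gamma> t) \<in> W"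
        by eventually_elim (use im g(2) in blast)
      show "\<phi> (\<gamma> 0) \<in> W" using \<phi>x g(3) by simp
    qed
  next
    fix v assume "v \<in> {v. D v \<in> W}"
    then have v: "D v \<in> W" by simp
    \<comment> \<open>A straight line inside \<open>W\<close>, pulled back by the inverse chart,
      stays in \<open>M\<close> for small \<open>t\<close> and has velocity
      \<open>E (D v) = v\<close>.\<close>
    define l where "l t = \<phi> x + t *\<^sub>R D v" for t :: real
    have "open (l -` V)"
      unfolding l_def using V by (intro open_vimage continuous_intros)
    moreover have "0 \<in> l -` V" using \<phi>x by (simp add: l_def)
    ultimately obtain \<epsilon> where e: "\<epsilon> > 0" "ball 0 \<epsilon> \<subseteq> l -` V"
      by (rule openE)
    then have lV: "l ` {-\<epsilon><..<\<epsilon>} \<subseteq> V"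
      by (auto simp: ball_eq_greaterThanLessThan)
    have lW: "l t \<in> W" for t
      using v \<phi>x W by (auto simp: l_def intro: subspace_add subspace_scale)
    have "Cn_on n {-\<epsilon><..<\<epsilon>} l" for n
      unfolding l_def by (intro Cn_on_add Cn_on_const Cn_on_bounded_linear bounded_linear_scaleR_left) auto
    then have "Ck_on 1 {-\<epsilon><..<\<epsilon>} (\<lambda>t. \<psi> (l t))"
      using ck(2) Cn_on_compose[OF _ V lV, of _ \<psi>] unfolding Ck_on_def by simp
    moreover have "(\<lambda>t. \<psi> (l t)) ` {-\<epsilon><..<\<epsilon>} \<subseteq> M"
    proof
      fix y assume "y \<in> (\<lambda>t. \<psi> (l t)) ` {-\<epsilon><..<\<epsilon>}"
      then obtain t where t: "y = \<psi> (l t)" "l t \<in> V" using lV by blast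
      then obtain z where "z \<in> U \<inter> M" "l t = \<phi> z" using im lW by blast
      then show "y \<in> M" using t inv by auto
    qed
    moreover have "((\<lambda>t. \<psi> (l t)) has_vector_derivative v) (at 0)"
    proof -
      have "(l has_vector_derivative D v) (at 0)"
        unfolding l_def by (auto intro!: derivative_eq_intros)
      then show ?thesis
        using vector_derivative_diff_chain_within[of l "D v" 0 UNIV \<psi> E] E
        by (simp add: o_def has_derivative_at_withinI ED l_def)
    qed
    ultimately show "v \<in> tangent_space M x"
      using e(1) inv(1)[OF U(2)] unfolding tangent_space_def
      by (intro CollectI exI[of _ "\<lambda>t. \<psi> (l t)"] exI[of _ \<epsilon>]) (simp add: l_def)
  qed
  moreover have "linear D" using D by (rule has_derivative_linear)
  ultimately show ?thesis using linear_subspace_vimage[OF _ W, of D] by (simp add: vimage_def)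
qed

text \<open>The sine of the angle is the distance from \<open>x\<close> to the tangent space, viewed
  as a linear subspace, divided by \<open>norm x\<close>. Any tangent vector \<open>w\<close> bounds
  that distance by \<open>norm (x - w)\<close>, so it suffices to exhibit one that is close to
  \<open>x\<close>.\<close>

lemma whitney_fun_le:
  fixes M :: "'a::euclidean_space set"
  assumes "subspace (tangent_space M x)" "w \<in> tangent_space M x" "x \<noteq> 0"
  shows "whitney_fun M x 0 \<le> norm (x - w) / norm x"
proof -
  define T where "T = tangent_space M x"
  have T: "subspace T" "w \<in> T" using assms by (simp_all add: T_def)
  obtain v z where v: "v \<in> span T" "\<And>t. t \<in> span T \<Longrightarrow> orthogonal z t" "- x = v + z"
    using orthogonal_subspace_decomp_exists[of T "- x"] by metis
  have sT: "span T = T" using T(1) by (simp add: span_eq_iff)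
  have proj: "orth_proj (affine_tangent_space M x) 0 = x + v"
    unfolding orth_proj_def affine_tangent_space_def T_def[symmetric]
  proof (rule the_equality)
    show "x + v \<in> (+) x ` T \<and> (\<forall>a\<in>(+) x ` T. orthogonal (0 - (x + v)) (a - (x + v)))"
    proof -
      have "0 - (x + v) = z" using v(3) by (simp add: algebra_simps)
      moreover have "orthogonal z (t - v)" if "t \<in> T" for t
        using v(1,2) that T(1) sT by (auto intro: subspace_diff)
      ultimately show ?thesis using v(1) sT by auto
    qed
    \<comment> \<open>Uniqueness of the projection: for a second candidate \<open>x + t\<close>, the
      vector \<open>v - t\<close> is orthogonal to itself.\<close>
    fix q assume q: "q \<in> (+) x ` T \<and> (\<forall>a\<in>(+) x ` T. orthogonal (0 - q) (a - q))"
    then obtain t where t: "q = x + t" "t \<in> T" by blast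
    have "orthogonal (0 - q) (x + v - q)" using q v(1) sT by blast
    moreover have "0 - q = z + (v - t)" "x + v - q = v - t"
      using v(3) t by (simp_all add: algebra_simps)
    ultimately have "orthogonal (z + (v - t)) (v - t)" by simp
    moreover have "orthogonal z (v - t)"
      using v(1,2) t T(1) sT by (auto intro: subspace_diff)
    ultimately have "(v - t) \<bullet> (v - t) = 0"
      unfolding orthogonal_def by (subst (asm) inner_add_left) simp
    then show "q = x + v" using t by simp
  qed
  have zv: "z \<bullet> v = 0" using v by (simp add: orthogonal_def)
  have nx: "(norm x)\<^sup>2 = (norm v)\<^sup>2 + (norm z)\<^sup>2"
  proof -
    have "(norm x)\<^sup>2 = (norm (v + z))\<^sup>2" using v(3) by (metis norm_minus_cancel)
    then show ?thesis using zv by (simp add: power2_norm_eq_inner inner_add_left inner_add_right inner_commute)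
  qed
  \<comment> \<open>For \<open>v = 0\<close> the left side is 0 by the convention on division by 0,
    so the formula covers the right angle too.\<close>
  have cosv: "\<bar>(0 - x) \<bullet> v\<bar> / (norm (0 - x) * norm v) = norm v / norm x"
  proof -
    have "(0 - x) \<bullet> v = (norm v)\<^sup>2"
      using zv v(3) by (simp add: inner_add_left power2_norm_eq_inner del: inner_minus_left)
    then show ?thesis by (simp add: power2_eq_square)
  qed
  have le1: "norm v / norm x \<le> 1"
  proof -
    have "(norm v)\<^sup>2 \<le> (norm x)\<^sup>2" using nx by simp
    then have "norm v \<le> norm x" by (rule power2_le_imp_le) simp
    then show ?thesis using assms(3) by (simp add: divide_le_eq)
  qed
  have "whitney_fun M x 0 = sin (arccos (norm v / norm x))"
    unfolding whitney_fun_def tangent_angle_def line_angle_def proj using cosv by simp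
  also have "\<dots> = sqrt (1 - (norm v / norm x)\<^sup>2)"
    using le1 by (intro sin_arccos) (auto intro: order_trans[of "-1" 0])
  also have "1 - (norm v / norm x)\<^sup>2 = (norm z / norm x)\<^sup>2"
  proof -
    have "(norm z)\<^sup>2 = (norm x)\<^sup>2 - (norm v)\<^sup>2" using nx by simp
    then show ?thesis using assms(3) by (simp add: power_divide diff_divide_distrib)
  qed
  also have "sqrt \<dots> = norm z / norm x" by simp
  finally have W: "whitney_fun M x 0 = norm z / norm x" .
  have "(norm z)\<^sup>2 \<le> (norm (x - w))\<^sup>2"
  proof -
    \<comment> \<open>Pythagoras: \<open>x - w\<close> splits into \<open>- z\<close>, normal to
      \<open>T\<close>, and \<open>- (v + w)\<close>, which lies in \<open>T\<close>.\<close>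
    have "v + w \<in> T" using v(1) sT T by (auto intro: subspace_add)
    then have 0: "z \<bullet> (v + w) = 0" using v(2) sT by (simp add: orthogonal_def)
    have "x = - (v + z)" using v(3) by (metis minus_minus)
    then have "x - w = - (z + (v + w))" by simp
    then have "(norm (x - w))\<^sup>2 = (norm (z + (v + w)))\<^sup>2" by (simp only: norm_minus_cancel)
    also have "\<dots> = (norm z)\<^sup>2 + 2 * (z \<bullet> (v + w)) + (norm (v + w))\<^sup>2"
      by (simp only: power2_norm_eq_inner inner_add_left[of z "v + w"] inner_add_right[of _ z "v + w"]
          inner_commute[of "v + w" z])
    finally show ?thesis using 0 by simp
  qed
  then have "norm z \<le> norm (x - w)" by (rule power2_le_imp_le) simp
  then show "whitney_fun M x 0 \<le> norm (x - w) / norm x"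
    unfolding W by (intro divide_right_mono) auto
qed

section \<open>The twisted plane\<close>

text \<open>The recursion serves three needs: even quotients make the faster waves vanish at the
  nodes of a slower one, the growth keeps the slower waves small at the first nodes of a faster one,
  and the factor 128 keeps those nodes below \<open>1/16\<close>.\<close>

primrec freq :: "nat \<Rightarrow> nat" where
  "freq 0 = 128"
| "freq (Suc k) = 128 * 64 ^ Suc k * freq k"

text \<open>Here \<open>q\<close> stands for the squared norm and \<open>v\<close> for
  \<open>x^2 / q\<close>. Wave \<open>k\<close> is switched off for \<open>2 ^ k * q >= 2\<close>
  and has amplitude at least \<open>(1/4) ^ k / 3\<close> once \<open>2 ^ k * q <= 1\<close>. The
  factor \<open>(1/4) ^ k\<close> outweighs the \<open>2 ^ k\<close> that differentiating the cutoff
  in \<open>q\<close> produces.\<close>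

definition wave :: "nat \<Rightarrow> real \<Rightarrow> real \<Rightarrow> real" where
  "wave k q v = (1/4) ^ k * flat 0 (2 - 2 ^ k * q) * sin (real (freq k) * v)"

definition angle :: "real \<Rightarrow> real \<Rightarrow> real" where
  "angle q v = (\<Sum>k. wave k q v)"

text \<open>The factor \<open>s\<close> puts the twist and its inverse into one family, so that
  regularity is proved once for both.\<close>

definition twist :: "real \<Rightarrow> real^3 \<Rightarrow> real^3" where
  "twist s p = (let a = s * angle (p \<bullet> p) ((p $ 1)\<^sup>2 / (p \<bullet> p)) in
     (p $ 1) *\<^sub>R axis 1 1 + (cos a * p $ 2 - sin a * p $ 3) *\<^sub>R axis 2 1
       + (sin a * p $ 2 + cos a * p $ 3) *\<^sub>R axis 3 1)"

definition xyplane :: "(real^3) set" where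
  "xyplane = {p. p $ 3 = 0}"

lemma angle_eq_sum:
  assumes "2 \<le> 2 ^ n * q"
  shows "angle q v = (\<Sum>k<n. wave k q v)"
  unfolding angle_def
proof (rule suminf_finite)
  fix k assume "k \<notin> {..<n}"
  then have "(2::real) ^ n \<le> 2 ^ k" by (intro power_increasing) auto
  moreover have "q > 0" using assms by (smt (verit) mult_nonneg_nonpos zero_le_power)
  ultimately have "2 ^ n * q \<le> 2 ^ k * q" by (intro mult_right_mono) auto
  then show "wave k q v = 0" using assms by (simp add: wave_def flat_def)
qed simp

section \<open>Algebra of the twists\<close>

lemma twist_nth [simp]:
  fixes p :: "real^3"
  defines "a \<equiv> angle (p \<bullet> p) ((p $ 1)\<^sup>2 / (p \<bullet> p))"
  shows "twist s p $ 1 = p $ 1"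
    and "twist s p $ 2 = cos (s * a) * p $ 2 - sin (s * a) * p $ 3"
    and "twist s p $ 3 = sin (s * a) * p $ 2 + cos (s * a) * p $ 3"
  by (simp_all add: twist_def Let_def axis_def a_def)

lemma inner_real3: "x \<bullet> y = x $ 1 * y $ 1 + x $ 2 * y $ 2 + x $ 3 * y $ 3" for x y :: "real^3"
  by (simp add: inner_vec_def sum_3)

lemma twist_inner_self [simp]: "twist s p \<bullet> twist s p = p \<bullet> p"
proof -
  define a where "a = angle (p \<bullet> p) ((p $ 1)\<^sup>2 / (p \<bullet> p))"
  have "(cos (s * a) * y - sin (s * a) * z) * (cos (s * a) * y - sin (s * a) * z) +
      (sin (s * a) * y + cos (s * a) * z) * (sin (s * a) * y + cos (s * a) * z) = y * y + z * z" (is "?L y z = _") for y z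
  proof -
    have "?L y z = ((sin (s * a))\<^sup>2 + (cos (s * a))\<^sup>2) * (y * y + z * z)"
      by algebra
    then show ?thesis by (simp only: sin_cos_squared_add mult_1)
  qed
  then show ?thesis
    unfolding inner_real3[of "twist s p"] twist_nth a_def[symmetric]
    unfolding inner_real3[of p] by (simp add: add.assoc)
qed

lemma norm_twist [simp]: "norm (twist s p) = norm p"
  by (simp add: norm_eq_sqrt_inner)

text \<open>The angle depends only on the first coordinate and the norm. The twist preserves both,
  so the second rotation undoes the first.\<close>

lemma twist_uminus_twist [simp]: "twist (- s) (twist s p) = p"
proof -
  define a where "a = angle (p \<bullet> p) ((p $ 1)\<^sup>2 / (p \<bullet> p))"
  have 1: "cos (s * a) * (cos (s * a) * y - sin (s * a) * z)
      + sin (s * a) * (sin (s * a) * y + cos (s * a) * z) = y" (is "?L y z = _") for y z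
  proof -
    have "?L y z = ((sin (s * a))\<^sup>2 + (cos (s * a))\<^sup>2) * y" by algebra
    then show ?thesis by (simp only: sin_cos_squared_add mult_1)
  qed
  have 2: "cos (s * a) * (sin (s * a) * y + cos (s * a) * z)
      - sin (s * a) * (cos (s * a) * y - sin (s * a) * z) = z" (is "?L y z = _") for y z
  proof -
    have "?L y z = ((sin (s * a))\<^sup>2 + (cos (s * a))\<^sup>2) * z" by algebra
    then show ?thesis by (simp only: sin_cos_squared_add mult_1)
  qed
  show ?thesis
    by (simp add: vec_eq_iff forall_3 1 2 flip: a_def)
qed

lemma twist_eq_0_iff [simp]: "twist s p = 0 \<longleftrightarrow> p = 0"
  by (metis norm_eq_zero norm_twist)

lemma twist_0 [simp]: "twist s 0 = 0"
  by (simp only: twist_eq_0_iff)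

text \<open>Near a point other than the origin the squared norm is bounded below, so on the open set
  \<open>V\<close> all waves from index \<open>n\<close> on vanish and a fixed finite sum of smooth
  terms remains.\<close>

lemma Cn_on_angle: "Cn_on m (- {0}) (\<lambda>p::real^3. angle (p \<bullet> p) ((p $ 1)\<^sup>2 / (p \<bullet> p)))"
proof (rule Cn_on_local)
  fix p :: "real^3" assume "p \<in> - {0}"
  then have "p \<bullet> p > 0" by simp
  obtain n where n: "2 / (p \<bullet> p) < 2 ^ n" using real_arch_pow[of 2 "2 / (p \<bullet> p)"] by auto
  define V where "V = {x :: real^3. 2 < 2 ^ n * (x \<bullet> x)}"
  have V: "open V" unfolding V_def by (intro open_Collect_less continuous_intros)
  have pV: "p \<in> V" using n \<open>p \<bullet> p > 0\<close> by (simp add: V_def field_simps)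
  have V0: "(\<lambda>x. x \<bullet> x) ` V \<subseteq> - {0}" by (auto simp: V_def)
  have sq: "Cn_on m V (\<lambda>x. x \<bullet> x)"
    by (rule Cn_on_inner[OF V]; rule Cn_on_bounded_linear[OF V bounded_linear_ident])
  have x1: "Cn_on m V (\<lambda>x. x $ 1)"
    by (intro Cn_on_bounded_linear V bounded_linear_vec_nth)
  have inv: "Cn_on m V (\<lambda>x. inverse (x \<bullet> x))"
    by (rule Cn_on_compose[OF V _ V0 Cn_on_inverse sq]) (simp add: open_Compl)
  have "Cn_on m V (\<lambda>x. real (freq k) * (x $ 1 * x $ 1 * inverse (x \<bullet> x)))" for k
    by (intro Cn_on_mult Cn_on_const x1 inv V)
  then have s: "Cn_on m V (\<lambda>x. sin (real (freq k) * (x $ 1 * x $ 1 * inverse (x \<bullet> x))))" for k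
    by (rule Cn_on_compose[OF V open_UNIV subset_UNIV conjunct1[OF Cn_on_sin_cos]])
  have "Cn_on m V (\<lambda>x. 2 + (- (2 ^ k)) * (x \<bullet> x))" for k
    by (intro Cn_on_add Cn_on_mult Cn_on_const sq V)
  then have f: "Cn_on m V (\<lambda>x. flat 0 (2 + (- (2 ^ k)) * (x \<bullet> x)))" for k
    by (rule Cn_on_compose[OF V open_UNIV subset_UNIV Cn_on_flat])
  have sum: "Cn_on m V (\<lambda>x. \<Sum>k<n. (1/4) ^ k * flat 0 (2 + (- (2 ^ k)) * (x \<bullet> x)) *
      sin (real (freq k) * (x $ 1 * x $ 1 * inverse (x \<bullet> x))))" (is "Cn_on m V ?S")
  proof (rule Cn_on_sum[OF V])
    fix k
    show "Cn_on m V (\<lambda>x. (1/4) ^ k * flat 0 (2 + (- (2 ^ k)) * (x \<bullet> x)) *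
        sin (real (freq k) * (x $ 1 * x $ 1 * inverse (x \<bullet> x))))"
      using Cn_on_mult[OF V Cn_on_const f[of k]] s[of k] by (rule Cn_on_mult[OF V])
  qed
  have eq: "?S x = angle (x \<bullet> x) ((x $ 1)\<^sup>2 / (x \<bullet> x))" if "x \<in> V" for x
  proof -
    have "2 \<le> 2 ^ n * (x \<bullet> x)" using that by (simp add: V_def)
    from angle_eq_sum[OF this] show ?thesis
      by (simp only: wave_def power2_eq_square divide_inverse) (simp add: mult.assoc)
  qed
  have C: "Cn_on m V (\<lambda>p. angle (p \<bullet> p) ((p $ 1)\<^sup>2 / (p \<bullet> p)))" (is "Cn_on m V ?A")
  proof -
    have "Cn_on m V ?S \<longleftrightarrow> Cn_on m V ?A"
      by (rule Cn_on_cong[OF V]) (rule eq)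
    then show ?thesis using sum by (rule iffD1)
  qed
  show "\<exists>V. open V \<and> p \<in> V \<and> Cn_on m V (\<lambda>p::real^3. angle (p \<bullet> p) ((p $ 1)\<^sup>2 / (p \<bullet> p)))"
    by (intro exI[of _ V] conjI V pV C)
qed

lemma Cn_on_twist: "Cn_on m (- {0}) (twist s)"
proof -
  have o: "open (- {0::real^3})" by (simp add: open_Compl)
  have a: "Cn_on m (- {0}) (\<lambda>p::real^3. s * angle (p \<bullet> p) ((p $ 1)\<^sup>2 / (p \<bullet> p)))"
    by (intro Cn_on_mult Cn_on_const Cn_on_angle o)
  define c where "c p = cos (s * angle (p \<bullet> p) ((p $ 1)\<^sup>2 / (p \<bullet> p)))" for p :: "real^3"
  define t where "t p = sin (s * angle (p \<bullet> p) ((p $ 1)\<^sup>2 / (p \<bullet> p)))" for p :: "real^3"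
  have c: "Cn_on m (- {0}) c"
    unfolding c_def by (rule Cn_on_compose[OF o open_UNIV subset_UNIV conjunct2[OF Cn_on_sin_cos] a])
  have t: "Cn_on m (- {0}) t"
    unfolding t_def by (rule Cn_on_compose[OF o open_UNIV subset_UNIV conjunct1[OF Cn_on_sin_cos] a])
  have x: "Cn_on m (- {0}) (\<lambda>p::real^3. p $ i)" for i
    by (intro Cn_on_bounded_linear o bounded_linear_vec_nth)
  have "Cn_on m (- {0}) (\<lambda>p::real^3. (p $ 1) *\<^sub>R axis 1 (1::real)
      + (c p * p $ 2 + (- 1) * (t p * p $ 3)) *\<^sub>R axis 2 1
      + (t p * p $ 2 + c p * p $ 3) *\<^sub>R axis 3 1 :: real^3)"
    by (intro Cn_on_add[OF o] Cn_on_scaleR[OF o] Cn_on_mult[OF o] Cn_on_const c t x)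
  also have "?this \<longleftrightarrow> ?thesis"
    by (rule Cn_on_cong[OF o]) (simp add: twist_def Let_def c_def t_def)
  finally show ?thesis .
qed

text \<open>Smoothness is only available off the origin; at the origin, preservation of the norm
  gives continuity.\<close>

lemma continuous_on_twist: "continuous_on UNIV (twist s)"
proof (rule continuous_at_imp_continuous_on, rule ballI)
  fix p :: "real^3"
  show "isCont (twist s) p"
  proof (cases "p = 0")
    case True
    have "(twist s \<longlongrightarrow> 0) (at 0)"
    proof (rule tendsto_norm_zero_cancel)
      show "((\<lambda>x. norm (twist s x)) \<longlongrightarrow> 0) (at 0)"
        using tendsto_norm_zero[OF tendsto_ident_at] by simp
    qed
    then show ?thesis unfolding True isCont_def by simp
  next
    case False
    have "continuous_on (- {0}) (twist s)" using Cn_on_twist[of 0 s] by simp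
    then show ?thesis using False by (simp add: continuous_on_eq_continuous_at open_Compl)
  qed
qed

section \<open>The twisted plane as a submanifold\<close>

lemma dim_xyplane: "subspace xyplane" "dim xyplane = 2"
proof -
  have eq: "xyplane = {p. axis 3 1 \<bullet> p = 0}"
    by (auto simp: xyplane_def inner_axis')
  show "subspace xyplane" unfolding eq by (rule subspace_hyperplane)
  have "axis 3 1 \<in> (Basis :: (real^3) set)" by (simp add: axis_in_Basis_iff)
  then show "dim xyplane = 2" unfolding eq by (subst dim_special_hyperplane) auto
qed

text \<open>A single ambient chart, \<open>twist (- 1)\<close> on \<open>U\<close>, serves all
  points. It is used with the whole space for class C^0 and with the complement of the origin for
  the smooth class.\<close>

lemma Ck_submanifold_twist:
  assumes "open U" "\<And>s. twist s ` U \<subseteq> U" "\<And>s. Ck_on k U (twist s)"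
  shows "Ck_submanifold k 2 (twist 1 ` (U \<inter> xyplane))"
proof -
  have inv: "twist (- 1) (twist 1 p) = p" "twist 1 (twist (- 1) p) = p" for p
    using twist_uminus_twist[of 1 p] twist_uminus_twist[of "- 1" p] by auto
  have sub: "twist s p \<in> U" if "p \<in> U" for s p
    using assms(2) that by blast
  have "twist (- 1) ` (U \<inter> twist 1 ` (U \<inter> xyplane)) = U \<inter> xyplane" (is "?L = _")
  proof
    show "?L \<subseteq> U \<inter> xyplane" by (auto simp: inv)
    show "U \<inter> xyplane \<subseteq> ?L"
    proof
      fix p assume p: "p \<in> U \<inter> xyplane"
      then have "twist 1 p \<in> U \<inter> twist 1 ` (U \<inter> xyplane)" using sub by blast
      then show "p \<in> ?L" using inv(1)[of p] by (metis image_eqI)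
    qed
  qed
  moreover have "homeomorphism U U (twist (- 1)) (twist 1)"
    using assms(2) by (intro homeomorphismI continuous_on_subset[OF continuous_on_twist] inv) simp_all
  moreover have "p \<in> U" if "p \<in> twist 1 ` (U \<inter> xyplane)" for p
    using that sub by blast
  ultimately show ?thesis
    unfolding Ck_submanifold_def using assms(1,3) dim_xyplane
    by (intro ballI exI[of _ U] exI[of _ "twist (-1)"] exI[of _ "twist 1"] exI[of _ xyplane] conjI)
qed

section \<open>The Whitney condition\<close>

lemma flat0_deriv: "(flat 0 has_real_derivative flat 2 t) (at t)"
  using has_real_derivative_flat[of 0 t] by (simp add: numeral_2_eq_2)

text \<open>Along a ray \<open>v\<close> is constant, so only the cutoffs are differentiated and no
  frequency appears as a factor. Term \<open>k\<close> contributes at most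
  \<open>(1/4) ^ k * 2 ^ k * 2 * q * 2\<close>, and the geometric series sums to at most
  \<open>8 * q\<close>.\<close>

lemma angle_dilation_derivative:
  assumes "q > 0"
  obtains a' where "((\<lambda>t. angle ((1 + t)\<^sup>2 * q) v) has_real_derivative a') (at 0)" "\<bar>a'\<bar> \<le> 8 * q"
proof -
  \<comment> \<open>For \<open>t > -1/2\<close> the dilation shrinks \<open>q\<close> by a factor of
    at most 4, so \<open>8 / 4 = 2\<close> still keeps the waves from index \<open>n\<close> on
    switched off.\<close>
  obtain n where n: "8 / q < 2 ^ n" using real_arch_pow[of 2 "8 / q"] by auto
  have n': "8 < 2 ^ n * q" using n assms by (simp add: field_simps)
  define a' where "a' = (\<Sum>k<n. (1/4) ^ k * (flat 2 (2 - 2 ^ k * q) * (- (2 ^ k * (2 * q)))) * sin (real (freq k) * v))"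
  have wave': "((\<lambda>t. wave k ((1 + t)\<^sup>2 * q) v) has_real_derivative
      (1/4) ^ k * (flat 2 (2 - 2 ^ k * q) * (- (2 ^ k * (2 * q)))) * sin (real (freq k) * v)) (at 0)" for k
  proof -
    have "((\<lambda>t. 2 - 2 ^ k * ((1 + t)\<^sup>2 * q)) has_real_derivative - (2 ^ k * (2 * q))) (at 0)"
      by (auto intro!: derivative_eq_intros)
    then have "((\<lambda>t. flat 0 (2 - 2 ^ k * ((1 + t)\<^sup>2 * q))) has_real_derivative
        flat 2 (2 - 2 ^ k * q) * (- (2 ^ k * (2 * q)))) (at 0)"
      using DERIV_chain2[OF flat0_deriv, of "\<lambda>t. 2 - 2 ^ k * ((1 + t)\<^sup>2 * q)" "- (2 ^ k * (2 * q))" 0 UNIV] by simp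
    then show ?thesis
      unfolding wave_def by (intro DERIV_cmult DERIV_cmult_right)
  qed
  have "((\<lambda>t. \<Sum>k<n. wave k ((1 + t)\<^sup>2 * q) v) has_real_derivative a') (at 0)"
    unfolding a'_def by (rule DERIV_sum) (rule wave')
  then have "((\<lambda>t. angle ((1 + t)\<^sup>2 * q) v) has_real_derivative a') (at 0)"
  proof (rule has_field_derivative_transform_within_open[where S = "{-1/2<..}"])
    fix t :: real assume "t \<in> {-1/2<..}"
    then have "(1/2)\<^sup>2 \<le> (1 + t)\<^sup>2" by (intro power_mono) auto
    then have "2 ^ n * q * (1/4) \<le> 2 ^ n * q * (1 + t)\<^sup>2"
      using assms by (intro mult_left_mono) (auto simp: power2_eq_square)
    then have "2 \<le> 2 ^ n * ((1 + t)\<^sup>2 * q)" using n' by (simp add: mult_ac)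
    from angle_eq_sum[OF this] show "(\<Sum>k<n. wave k ((1 + t)\<^sup>2 * q) v) = angle ((1 + t)\<^sup>2 * q) v"
      by simp
  qed auto
  moreover have "\<bar>a'\<bar> \<le> 8 * q"
  proof -
    have "\<bar>a'\<bar> \<le> (\<Sum>k<n. \<bar>(1/4) ^ k * (flat 2 (2 - 2 ^ k * q) * (- (2 ^ k * (2 * q)))) * sin (real (freq k) * v)\<bar>)"
      unfolding a'_def by (rule sum_abs)
    also have "\<dots> \<le> (\<Sum>k<n. (4 * q) * (1/2) ^ k)"
    proof (rule sum_mono)
      fix k
      have f: "flat 2 (2 - 2 ^ k * q) \<le> 2" "0 \<le> flat 2 (2 - 2 ^ k * q)"
        using abs_flat_le[of 2 "2 - 2 ^ k * q" 0] flat_nonneg by (auto simp: numeral_2_eq_2)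
      have "\<bar>(1/4) ^ k * (flat 2 (2 - 2 ^ k * q) * (- (2 ^ k * (2 * q)))) * sin (real (freq k) * v)\<bar>
          = ((1/4) ^ k * 2 ^ k) * (2 * q) * (flat 2 (2 - 2 ^ k * q) * \<bar>sin (real (freq k) * v)\<bar>)"
        using assms f by (simp add: abs_mult)
      also have "(1/4) ^ k * 2 ^ k = (1/2 :: real) ^ k" by (simp flip: power_mult_distrib)
      also have "(1/2) ^ k * (2 * q) * (flat 2 (2 - 2 ^ k * q) * \<bar>sin (real (freq k) * v)\<bar>)
          \<le> (1/2) ^ k * (2 * q) * (2 * 1)"
        using f assms by (intro mult_left_mono mult_mono) auto
      finally show "\<bar>(1/4) ^ k * (flat 2 (2 - 2 ^ k * q) * (- (2 ^ k * (2 * q)))) * sin (real (freq k) * v)\<bar>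
          \<le> 4 * q * (1/2) ^ k"
        by (simp add: mult_ac)
    qed
    also have "\<dots> = 4 * q * (\<Sum>k<n. (1/2) ^ k)" by (simp add: sum_distrib_left)
    also have "\<dots> \<le> 4 * q * 2"
      using assms by (intro mult_left_mono) (auto simp: sum_gp_strict)
    finally show ?thesis by simp
  qed
  ultimately show ?thesis using that by blast
qed

text \<open>The image of the ray through \<open>p\<close> has velocity
  \<open>w = twist 1 p + a' *\<^sub>R e\<close> at \<open>twist 1 p\<close>, with
  \<open>norm e <= norm p\<close>. Hence this tangent vector differs from the position vector by at
  most \<open>8 * q * norm p\<close>.\<close>

lemma whitney_fun_twist_le:
  fixes p :: "real^3"
  assumes p: "p \<in> xyplane" "p \<noteq> 0"
  defines "M \<equiv> twist 1 ` (- {0} \<inter> xyplane)"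
  assumes M: "Ck_submanifold \<infinity> 2 M"
  shows "whitney_fun M (twist 1 p) 0 \<le> 8 * (norm p)\<^sup>2"
proof -
  define q v where "q = p \<bullet> p" and "v = (p $ 1)\<^sup>2 / (p \<bullet> p)"
  have q: "q > 0" using p by (simp add: q_def)
  obtain a' where a': "((\<lambda>t. angle ((1 + t)\<^sup>2 * q) v) has_real_derivative a') (at 0)" "\<bar>a'\<bar> \<le> 8 * q"
    using angle_dilation_derivative[OF q] .
  define a where "a = angle q v"
  define g where "g t = twist 1 ((1 + t) *\<^sub>R p)" for t
  have p3: "p $ 3 = 0" using p by (simp add: xyplane_def)
  have g1: "g t $ 1 = (1 + t) * p $ 1" for t
    by (simp add: g_def)
  have ang: "angle (((1 + t) *\<^sub>R p) \<bullet> ((1 + t) *\<^sub>R p)) ((((1 + t) *\<^sub>R p) $ 1)\<^sup>2 / (((1 + t) *\<^sub>R p) \<bullet> ((1 + t) *\<^sub>R p)))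
      = angle ((1 + t)\<^sup>2 * q) v" if "t > -1" for t
    using that by (simp add: q_def v_def power2_eq_square mult_ac)
  have g23: "g t $ 2 = cos (angle ((1 + t)\<^sup>2 * q) v) * ((1 + t) * p $ 2)"
    "g t $ 3 = sin (angle ((1 + t)\<^sup>2 * q) v) * ((1 + t) * p $ 2)" if "t > -1" for t
    unfolding g_def using ang[OF that] p3 by simp_all
  \<comment> \<open>The derivative of the rotated point with respect to the rotation angle.\<close>
  define e :: "real^3" where "e = (- (sin a * p $ 2)) *\<^sub>R axis 2 1 + (cos a * p $ 2) *\<^sub>R axis 3 1"
  define w where "w = twist 1 p + a' *\<^sub>R e"
  have a0: "angle (p \<bullet> p) ((p $ 1)\<^sup>2 / (p \<bullet> p)) = a" by (simp add: a_def q_def v_def)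
  have sub: "subspace (tangent_space M (twist 1 p))"
    by (rule subspace_tangent_space[OF M]) (use p in \<open>auto simp: M_def\<close>)
  have "w \<in> tangent_space M (twist 1 p)"
    unfolding tangent_space_def
  proof (intro CollectI exI conjI)
    show "Ck_on 1 {-1<..<1} g"
    proof -
      have "Cn_on n {-1<..<1} (\<lambda>t. p + t *\<^sub>R p)" for n
        by (intro Cn_on_add Cn_on_const Cn_on_bounded_linear bounded_linear_scaleR_left) auto
      moreover have "(\<lambda>t. p + t *\<^sub>R p) = (\<lambda>t. (1 + t) *\<^sub>R p)" by (simp add: scaleR_add_left)
      ultimately have *: "Cn_on n {-1<..<1} (\<lambda>t. (1 + t) *\<^sub>R p)" for n by simp
      have "(\<lambda>t. (1 + t) *\<^sub>R p) ` {-1<..<1} \<subseteq> - {0}" using p by auto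
      from Cn_on_compose[OF _ _ this Cn_on_twist *]
      show ?thesis by (auto simp: Ck_on_def g_def[abs_def] open_Compl)
    qed
    show "g ` {-1<..<1} \<subseteq> M"
      using p by (auto simp: g_def M_def xyplane_def)
    show "g 0 = twist 1 p" by (simp add: g_def)
    show "(g has_vector_derivative w) (at 0)"
    proof -
      have d: "((\<lambda>t. (1 + t) * p $ i) has_real_derivative p $ i) (at 0)" for i
        by (auto intro!: derivative_eq_intros)
      have dc: "((\<lambda>t. cos (angle ((1 + t)\<^sup>2 * q) v) * ((1 + t) * p $ 2)) has_real_derivative
          cos a * p $ 2 - a' * (sin a * p $ 2)) (at 0)"
        by (rule derivative_eq_intros a'(1) d refl)+ (simp add: a_def)
      have ds: "((\<lambda>t. sin (angle ((1 + t)\<^sup>2 * q) v) * ((1 + t) * p $ 2)) has_real_derivative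
          sin a * p $ 2 + a' * (cos a * p $ 2)) (at 0)"
        by (rule derivative_eq_intros a'(1) d refl)+ (simp add: a_def)
      have sc: "((\<lambda>t. f t *\<^sub>R c) has_vector_derivative f' *\<^sub>R c) (at 0)"
        if "(f has_real_derivative f') (at 0)" for f f' and c :: "real^3"
        using has_vector_derivative_scaleR[OF that has_vector_derivative_const[of c]] by simp
      define G where "G t = (((1 + t) * p $ 1) *\<^sub>R axis 1 1
          + (cos (angle ((1 + t)\<^sup>2 * q) v) * ((1 + t) * p $ 2)) *\<^sub>R axis 2 1
          + (sin (angle ((1 + t)\<^sup>2 * q) v) * ((1 + t) * p $ 2)) *\<^sub>R axis 3 1 :: real^3)" for t
      have "(G has_vector_derivative (p $ 1) *\<^sub>R axis 1 1 + (cos a * p $ 2 - a' * (sin a * p $ 2)) *\<^sub>R axis 2 1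
          + (sin a * p $ 2 + a' * (cos a * p $ 2)) *\<^sub>R axis 3 1) (at 0)"
        unfolding G_def
        by (intro has_vector_derivative_add sc d dc ds)
      also have "(p $ 1) *\<^sub>R axis 1 1 + (cos a * p $ 2 - a' * (sin a * p $ 2)) *\<^sub>R axis 2 1
          + (sin a * p $ 2 + a' * (cos a * p $ 2)) *\<^sub>R axis 3 1 = w"
        by (simp add: vec_eq_iff forall_3 w_def e_def a0 p3 axis_def)
      finally show ?thesis
      proof (rule has_vector_derivative_transform_within_open)
        show "G t = g t" if "t \<in> {-1<..<1}" for t
          using that by (simp add: vec_eq_iff forall_3 G_def g1 g23 axis_def)
      qed auto
    qed
  qed simp
  then have "whitney_fun M (twist 1 p) 0 \<le> norm (twist 1 p - w) / norm (twist 1 p)"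
    using whitney_fun_le[OF sub, of w] p by simp
  have "norm e \<le> norm p"
  proof -
    have "e \<bullet> e = (sin a * p $ 2) * (sin a * p $ 2) + (cos a * p $ 2) * (cos a * p $ 2)"
      unfolding inner_real3 e_def by (simp add: axis_def)
    also have "\<dots> = ((sin a)\<^sup>2 + (cos a)\<^sup>2) * (p $ 2 * p $ 2)" by algebra
    finally have "e \<bullet> e = p $ 2 * p $ 2" by (simp only: sin_cos_squared_add mult_1)
    then have "e \<bullet> e \<le> p \<bullet> p" unfolding inner_real3[of p] by simp
    then show ?thesis by (simp add: norm_eq_sqrt_inner)
  qed
  have "norm (twist 1 p - w) = \<bar>a'\<bar> * norm e" by (simp add: w_def)
  also have "\<dots> \<le> 8 * q * norm p"
    using a'(2) \<open>norm e \<le> norm p\<close> q by (intro mult_mono) auto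
  finally have "norm (twist 1 p - w) / norm (twist 1 p) \<le> 8 * q"
    using p by (simp add: divide_le_eq)
  with \<open>whitney_fun M (twist 1 p) 0 \<le> _\<close> show "whitney_fun M (twist 1 p) 0 \<le> 8 * (norm p)\<^sup>2"
    by (simp add: q_def power2_norm_eq_inner)
qed

section \<open>Length of the spherical sections\<close>

lemma freq_pos: "freq k > 0"
  by (induction k) simp_all

lemma freq_ge: "128 * 64 ^ k \<le> freq k"
proof (cases k)
  case (Suc l)
  have "128 * 64 ^ Suc l * 1 \<le> 128 * 64 ^ Suc l * freq l"
    using freq_pos[of l] by (intro mult_le_mono) auto
  then show ?thesis using Suc by simp
qed simp

text \<open>The sum bounds the total slope in \<open>v\<close> of the waves slower than wave
  \<open>k\<close>. In the induction the sum is at most \<open>2 * freq k\<close>, and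
  \<open>2 * 64\<close> is the factor 128 of the recursion.\<close>

lemma freq_sum_le: "(\<Sum>j<k. (1/4) ^ j * real (freq j)) * (64 * 64 ^ k) \<le> real (freq k)"
proof (induction k)
  case (Suc k)
  let ?S = "\<Sum>j<k. (1/4) ^ j * real (freq j)"
  have "?S * 1 \<le> ?S * (64 * 64 ^ k)"
    using one_le_power[of "64::real" "Suc k"] by (intro mult_left_mono sum_nonneg) auto
  then have "?S \<le> freq k" using Suc by linarith
  moreover have "(1/4) ^ k * real (freq k) \<le> freq k"
    using power_le_one[of "1/4::real" k] by (intro mult_left_le_one_le) auto
  ultimately have "(\<Sum>j<Suc k. (1/4) ^ j * real (freq j)) \<le> 2 * freq k" by simp
  then have "(\<Sum>j<Suc k. (1/4) ^ j * real (freq j)) * (64 * 64 ^ Suc k) \<le> 2 * real (freq k) * (64 * 64 ^ Suc k)"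
    by (intro mult_right_mono) auto
  then show ?case by (simp add: mult.assoc mult.left_commute)
qed simp

lemma freq_dvd: "k < j \<Longrightarrow> 2 * freq k dvd freq j"
proof (induction j)
  case (Suc j)
  show ?case
  proof (cases "j = k")
    case True
    have "freq (Suc k) = 2 * freq k * (64 * 64 ^ Suc k)" by simp
    then show ?thesis using True by (metis dvd_triv_left)
  next
    case False
    then show ?thesis using Suc by (simp add: dvd_mult)
  qed
qed simp

text \<open>
  The extrema of wave \<open>k\<close>. All faster waves vanish there because the frequencies are even multiples
  of \<open>freq k\<close>, and the slower ones are still small as the first nodes lie close to 0.
\<close>
definition node :: "nat \<Rightarrow> nat \<Rightarrow> real" where
  "node k m = (real m + 1/2) * pi / freq k"

lemma freq_times_node: "real (freq k) * node k m = (real m + 1/2) * pi"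
  using freq_pos[of k] by (simp add: node_def)

lemma sin_even_node: "sin (real (freq k) * node k (2 * m)) = 1"
proof -
  have "real (freq k) * node k (2 * m) = 2 * real m * pi + pi / 2"
    unfolding freq_times_node by (simp add: algebra_simps)
  then show ?thesis by (simp only: sin_add sin_2npi cos_2npi) simp
qed

lemma sin_odd_node: "sin (real (freq k) * node k (2 * m + 1)) = - 1"
proof -
  have "real (freq k) * node k (2 * m + 1) = 2 * real m * pi + (pi / 2 + pi)"
    unfolding freq_times_node by (simp add: algebra_simps)
  then show ?thesis by (simp only: sin_add[of "2 * real m * pi"] sin_2npi cos_2npi sin_periodic_pi sin_pi_half mult_zero_left mult_1 add_0)
qed

lemma wave_node_eq_0:
  assumes "k < j"
  shows "wave j q (node k m) = 0"
proof -
  obtain c where "freq j = 2 * freq k * c" using freq_dvd[OF assms] by (rule dvdE)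
  then have "real (freq j) * node k m = 2 * real c * (real (freq k) * node k m)" by simp
  also have "\<dots> = real (c * (2 * m + 1)) * pi"
    unfolding freq_times_node by (simp add: algebra_simps)
  finally have "sin (real (freq j) * node k m) = 0" by (simp only: sin_npi)
  then show ?thesis by (simp add: wave_def)
qed

text \<open>The range of \<open>m\<close> covers the \<open>16 ^ k\<close> pairs of consecutive
  nodes used in the length estimate.\<close>

lemma node_bounds:
  assumes "m < 2 * 16 ^ k"
  shows "0 < node k m" "node k m \<le> 8 * 16 ^ k / freq k" "node k m \<le> 1/16"
proof -
  show "0 < node k m" using freq_pos[of k] by (simp add: node_def)
  have "real m + 1 \<le> 2 * 16 ^ k"
    using assms of_nat_mono[of "m + 1" "2 * 16 ^ k", where 'a = real] by simp
  then have "(real m + 1/2) * pi \<le> (2 * 16 ^ k) * 4"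
    using pi_less_4 by (intro mult_mono) auto
  then show *: "node k m \<le> 8 * 16 ^ k / freq k"
    unfolding node_def by (intro divide_right_mono) auto
  have "(128 * 16 ^ k :: real) \<le> 128 * 64 ^ k" by (intro mult_left_mono power_mono) auto
  also have "\<dots> \<le> freq k" using of_nat_mono[OF freq_ge[of k], where 'a = real] by simp
  finally have "8 * 16 ^ k / real (freq k) \<le> 1/16"
    using freq_pos[of k] by (simp add: field_simps)
  then show "node k m \<le> 1/16" using * by linarith
qed

text \<open>The slower waves contribute at most their total slope times the node, that is
  \<open>freq k / (64 * 64 ^ k)\<close> times \<open>8 * 16 ^ k / freq k\<close>. The result is
  below the amplitude \<open>(1/4) ^ k / 3\<close> of wave \<open>k\<close>, so wave
  \<open>k\<close> decides the sign.\<close>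

lemma angle_node:
  assumes "0 < q" "2 ^ k * q \<le> 1" "m < 2 * 16 ^ k"
  shows "\<bar>angle q (node k m) - wave k q (node k m)\<bar> \<le> (1/8) * (1/4) ^ k"
proof -
  let ?v = "node k m"
  obtain n where n: "2 / q < 2 ^ n" using real_arch_pow[of 2 "2 / q"] by auto
  have n': "2 < 2 ^ n * q" using n assms(1) by (simp add: field_simps)
  have "k < n"
  proof (rule ccontr)
    assume "\<not> k < n"
    then have "(2::real) ^ n * q \<le> 2 ^ k * q"
      using assms(1) by (intro mult_right_mono power_increasing) auto
    then show False using n' assms(2) by linarith
  qed
  have "angle q ?v = (\<Sum>j<n. wave j q ?v)" by (rule angle_eq_sum) (use n' in simp)
  also have "\<dots> = (\<Sum>j<Suc k. wave j q ?v)"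
    using \<open>k < n\<close> by (intro sum.mono_neutral_right) (auto intro: wave_node_eq_0)
  finally have "\<bar>angle q ?v - wave k q ?v\<bar> = \<bar>\<Sum>j<k. wave j q ?v\<bar>" by simp
  also have "\<dots> \<le> (\<Sum>j<k. \<bar>wave j q ?v\<bar>)" by (rule sum_abs)
  also have "\<dots> \<le> (\<Sum>j<k. (1/4) ^ j * real (freq j) * ?v)"
  proof (rule sum_mono)
    fix j
    have "\<bar>wave j q ?v\<bar> = (1/4) ^ j * (\<bar>flat 0 (2 - 2 ^ j * q)\<bar> * \<bar>sin (real (freq j) * ?v)\<bar>)"
      by (simp add: wave_def abs_mult)
    also have "\<dots> \<le> (1/4) ^ j * (1 * \<bar>real (freq j) * ?v\<bar>)"
      using abs_flat_le[of 0 _ 0] abs_sin_x_le_abs_x by (intro mult_left_mono mult_mono) auto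
    finally show "\<bar>wave j q ?v\<bar> \<le> (1/4) ^ j * real (freq j) * ?v"
      using node_bounds(1)[OF assms(3)] by (simp add: abs_mult)
  qed
  also have "\<dots> = (\<Sum>j<k. (1/4) ^ j * real (freq j)) * ?v" by (simp add: sum_distrib_right)
  also have "\<dots> \<le> (freq k / (64 * 64 ^ k)) * (8 * 16 ^ k / freq k)"
    using freq_sum_le[of k] node_bounds(1,2)[OF assms(3)]
    by (intro mult_mono) (auto simp: le_divide_eq)
  also have "\<dots> = (1/8) * (16 ^ k / 64 ^ k)" using freq_pos[of k] by simp
  also have "(16 ^ k / 64 ^ k :: real) = (1/4) ^ k" by (simp flip: power_divide)
  finally show ?thesis .
qed

section \<open>Sign and size of the height at the nodes\<close>

lemma half_le_sin:
  fixes x :: real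
  assumes "0 \<le> x" "x \<le> 1"
  shows "x / 2 \<le> sin x"
proof (cases "x = 0")
  case False
  then obtain z where z: "0 < z" "z < x" "sin x - sin 0 = (x - 0) * cos z"
    using MVT2[of 0 x sin cos] assms by (auto intro: DERIV_sin)
  \<comment> \<open>Since \<open>z < 1 < pi / 3\<close>, the cosine stays above
    \<open>1/2\<close>.\<close>
  have "cos (pi / 3) \<le> cos z"
    using z assms pi_gt3 by (intro cos_monotone_0_pi_le) auto
  then have "x * (1/2) \<le> x * cos z" using assms by (intro mult_left_mono) (auto simp: cos_60)
  then show ?thesis using z by simp
qed simp

lemma flat0_bounds:
  assumes "1 \<le> t"
  shows "1/3 \<le> flat 0 t" "flat 0 t \<le> 1"
proof -
  have eq: "flat 0 t = exp (- 1 / t)" using assms by (simp add: flat_def)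
  have "exp (- 1 :: real) \<ge> 1/3" using exp_le by (simp add: exp_minus field_simps)
  moreover have "exp (- 1) \<le> exp (- 1 / t)" using assms by (simp add: field_simps)
  ultimately show "1/3 \<le> flat 0 t" unfolding eq by linarith
  show "flat 0 t \<le> 1" unfolding eq using assms by simp
qed

text \<open>Because \<open>1/3 - 1/8 >= 1/6\<close>, the number \<open>x\<close> lies between
  \<open>e / 6\<close> and \<open>9/8 < pi / 2\<close>, where the sine is increasing;
  \<open>half_le_sin\<close> then costs another factor 2.\<close>

lemma sin_bound_of_near:
  fixes x c e :: real
  assumes "\<bar>x - c * e\<bar> \<le> (1/8) * e" "1/3 \<le> c" "c \<le> 1" "0 < e" "e \<le> 1"
  shows "e / 12 \<le> sin x"
proof -
  have "1/3 * e \<le> c * e" "c * e \<le> 1 * e" using assms by (intro mult_right_mono; simp)+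
  moreover have "x - c * e \<le> (1/8) * e" "c * e - x \<le> (1/8) * e"
    using assms(1) unfolding abs_le_iff by simp_all
  ultimately have x: "e / 6 \<le> x" "x \<le> 9/8" using assms(4,5) by linarith+
  have "e / 6 / 2 \<le> sin (e / 6)" using assms by (intro half_le_sin) auto
  also have "sin (e / 6) \<le> sin x"
    using x assms pi_gt3 by (intro sin_monotone_2pi_le) auto
  finally show ?thesis by simp
qed

lemma sin_angle_node:
  assumes "0 < q" "2 ^ k * q \<le> 1" "m < 16 ^ k"
  shows "(1/4) ^ k / 12 \<le> sin (angle q (node k (2 * m)))"
    and "sin (angle q (node k (2 * m + 1))) \<le> - ((1/4) ^ k / 12)"
proof -
  let ?c = "flat 0 (2 - 2 ^ k * q)"
  have c: "1/3 \<le> ?c" "?c \<le> 1" using flat0_bounds assms(2) by auto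
  have e: "0 < (1/4::real) ^ k" "(1/4::real) ^ k \<le> 1" by (auto intro: power_le_one)
  have "\<bar>angle q (node k (2 * m)) - ?c * (1/4) ^ k\<bar> \<le> (1/8) * (1/4) ^ k"
    using angle_node[OF assms(1,2), of "2 * m"] assms(3) sin_even_node[of k m]
    by (simp add: wave_def mult.commute)
  then show "(1/4) ^ k / 12 \<le> sin (angle q (node k (2 * m)))"
    by (rule sin_bound_of_near) (use c e in auto)
  have "\<bar>angle q (node k (2 * m + 1)) + ?c * (1/4) ^ k\<bar> \<le> (1/8) * (1/4) ^ k"
    using angle_node[OF assms(1,2), of "2 * m + 1"] assms(3) sin_odd_node[of k m]
    by (simp add: wave_def mult.commute)
  then have "\<bar>- angle q (node k (2 * m + 1)) - ?c * (1/4) ^ k\<bar> \<le> (1/8) * (1/4) ^ k"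
    by linarith
  then have "(1/4) ^ k / 12 \<le> sin (- angle q (node k (2 * m + 1)))"
    by (rule sin_bound_of_near) (use c e in auto)
  then show "sin (angle q (node k (2 * m + 1))) \<le> - ((1/4) ^ k / 12)" by simp
qed

lemma continuous_on_angle:
  assumes "q > 0"
  shows "continuous_on A (angle q)"
proof -
  obtain n where n: "2 / q < 2 ^ n" using real_arch_pow[of 2 "2 / q"] by auto
  then have n': "2 \<le> 2 ^ n * q" using assms by (simp add: field_simps)
  have "angle q = (\<lambda>v. \<Sum>k<n. wave k q v)" by (rule ext) (rule angle_eq_sum[OF n'])
  then show ?thesis unfolding wave_def by (auto intro!: continuous_intros)
qed

text \<open>Between the two nodes of each of \<open>16 ^ k\<close> pairs the height falls from at
  least \<open>h\<close> to at most \<open>- h\<close>. Every height in between is thus attained at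
  \<open>16 ^ k\<close> separated points, and \<open>hausdorff1_pre_ge\<close> gives length at least
  \<open>16 ^ k * h\<close>.\<close>

lemma hausdorff1_sphere_ge:
  assumes r: "0 < r" "r \<le> 1"
  shows "ennreal (1 / (96 * r\<^sup>2)) \<le> hausdorff1 (sphere 0 r \<inter> twist 1 ` xyplane)"
proof -
  define q where "q = r\<^sup>2"
  have q: "0 < q" "q \<le> 1" using r by (auto simp: q_def power_le_one)
  \<comment> \<open>The dyadic scale of \<open>q\<close>:
    \<open>(1/2) ^ Suc k < q <= (1/2) ^ k\<close>, with \<open>r <= 1\<close> supplying the upper
    bound for \<open>k = 0\<close>. Wave \<open>k\<close> is then fully active.\<close>
  define k where "k = (LEAST k. (1/2) ^ Suc k < q)"
  have "\<exists>k. (1/2) ^ Suc k < q"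
  proof -
    obtain n where "(1/2) ^ n < q" using real_arch_pow_inv[of q "1/2"] q by auto
    moreover have "(1/2::real) ^ Suc n \<le> (1/2) ^ n" by simp
    ultimately show ?thesis by (intro exI[of _ n]) linarith
  qed
  then have k1: "(1/2) ^ Suc k < q" unfolding k_def by (rule LeastI_ex)
  have k2: "q \<le> (1/2) ^ k"
  proof (cases k)
    case (Suc l)
    then have "\<not> (1/2) ^ Suc l < q" using not_less_Least[of l "\<lambda>k. (1/2) ^ Suc k < q"] by (simp add: k_def)
    then show ?thesis using Suc by simp
  qed (use q in simp)
  have kq: "2 ^ k * q \<le> 1" using k2 by (simp add: power_one_over field_simps)
  \<comment> \<open>The twisted image of a quarter circle in the plane, parametrized by
    \<open>v = x^2 / r^2\<close>, the variable in which the waves oscillate.\<close>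
  define P where "P v = twist 1 ((r * sqrt v) *\<^sub>R axis 1 1 + (r * sqrt (1 - v)) *\<^sub>R axis 2 1)" for v
  have P: "P v \<in> sphere 0 r \<inter> twist 1 ` xyplane" "P v $ 1 = r * sqrt v"
    "P v $ 3 = r * sqrt (1 - v) * sin (angle q v)" if "0 \<le> v" "v \<le> 1" for v
  proof -
    define b :: "real^3" where "b = (r * sqrt v) *\<^sub>R axis 1 1 + (r * sqrt (1 - v)) *\<^sub>R axis 2 1"
    have b: "b $ 1 = r * sqrt v" "b $ 2 = r * sqrt (1 - v)" "b $ 3 = 0"
      by (simp_all add: b_def axis_def)
    have "b \<bullet> b = r\<^sup>2 * ((sqrt v)\<^sup>2 + (sqrt (1 - v))\<^sup>2)"
      unfolding inner_real3 b by (simp add: power2_eq_square algebra_simps)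
    then have bb: "b \<bullet> b = q" using that by (simp add: q_def)
    have bv: "(b $ 1)\<^sup>2 / (b \<bullet> b) = v"
      unfolding bb b using that r by (simp add: q_def power_mult_distrib)
    have Pb: "P v = twist 1 b" by (simp add: P_def b_def)
    have "norm b = r" using bb r by (simp add: norm_eq_sqrt_inner q_def)
    then show "P v \<in> sphere 0 r \<inter> twist 1 ` xyplane"
      unfolding Pb using b by (auto simp: xyplane_def)
    show "P v $ 1 = r * sqrt v" "P v $ 3 = r * sqrt (1 - v) * sin (angle q v)"
      unfolding Pb twist_nth bb bv[unfolded bb] by (simp_all add: b)
  qed
  \<comment> \<open>The product of \<open>r / 2\<close>, a lower bound for
    \<open>r * sqrt (1 - v)\<close> at the nodes, and the bound \<open>(1/4) ^ k / 12\<close> for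
    the sine.\<close>
  define h where "h = r * (1/4) ^ k / 24"
  define g where "g v = r * sqrt (1 - v) * sin (angle q v)" for v
  have g_cont: "continuous_on A g" for A
    unfolding g_def using continuous_on_angle[OF q(1)] by (auto intro!: continuous_intros)
  have node_le: "node k m \<le> 1/16" "0 < node k m" if "m < 2 * 16 ^ k" for m
    using node_bounds[OF that] by auto
  have root: "r / 2 \<le> r * sqrt (1 - node k m)" if "m < 2 * 16 ^ k" for m
  proof -
    have "sqrt ((1/2)\<^sup>2) \<le> sqrt (1 - node k m)"
      using node_le(1)[OF that] by (intro real_sqrt_le_mono) (simp add: power2_eq_square)
    then show ?thesis using mult_left_mono[of "1/2" "sqrt (1 - node k m)" r] r by simp
  qed
  have root0: "0 \<le> r * sqrt (1 - node k m)" if "m < 2 * 16 ^ k" for m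
    using root[OF that] r by linarith
  have h: "h = r / 2 * ((1/4) ^ k / 12)" by (simp add: h_def)
  have g_even: "h \<le> g (node k (2 * m))" if "m < 16 ^ k" for m
    unfolding h g_def using that
    by (intro mult_mono root root0 sin_angle_node(1)[OF q(1) kq that]) auto
  have g_odd: "g (node k (2 * m + 1)) \<le> - h" if "m < 16 ^ k" for m
  proof -
    have "h \<le> r * sqrt (1 - node k (2 * m + 1)) * - sin (angle q (node k (2 * m + 1)))"
      unfolding h using that sin_angle_node(2)[OF q(1) kq that]
      by (intro mult_mono root root0) auto
    then show ?thesis by (simp add: g_def)
  qed
  \<comment> \<open>Points of different pairs differ in \<open>v\<close> by at least
    \<open>pi / freq k\<close>. Passing to \<open>sqrt v\<close> costs a factor of at most 2, so
    their first coordinates differ by more than \<open>\<delta>\<close>.\<close>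
  define \<delta> where "\<delta> = r / (2 * freq k)"
  have \<delta>: "\<delta> > 0" using r freq_pos[of k] by (simp add: \<delta>_def)
  have node_mono: "node k i \<le> node k j" if "i \<le> j" for i j
    using that unfolding node_def by (intro divide_right_mono mult_right_mono) auto
  have "ennreal (real (16 ^ k) * h) \<le> hausdorff1_pre \<delta> (sphere 0 r \<inter> twist 1 ` xyplane)"
  proof (rule hausdorff1_pre_ge[where p = "\<lambda>x. x $ 3"])
    show "\<bar>x $ 3 - y $ 3\<bar> \<le> dist x y" for x y :: "real^3"
      using component_le_norm_cart[of "x - y" 3] by (simp add: dist_norm)
  next
    fix y assume y: "y \<in> {-h..h}"
    have "\<exists>v. node k (2 * m) \<le> v \<and> v \<le> node k (2 * m + 1) \<and> g v = y" if "m < 16 ^ k" for m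
      using g_even[OF that] g_odd[OF that] y by (intro IVT2' node_mono g_cont) auto
    then obtain v where v: "\<And>m. m < 16 ^ k \<Longrightarrow> node k (2 * m) \<le> v m"
      "\<And>m. m < 16 ^ k \<Longrightarrow> v m \<le> node k (2 * m + 1)" "\<And>m. m < 16 ^ k \<Longrightarrow> g (v m) = y"
      by metis
    have v01: "0 \<le> v m" "v m \<le> 1" if "m < 16 ^ k" for m
      using v(1,2)[OF that] node_le[of "2 * m"] node_le[of "2 * m + 1"] that by auto
    have sep: "\<delta> < dist (P (v j)) (P (v i))" if "i < 16 ^ k" "j < i" for i j
    proof -
      have j: "j < 16 ^ k" using that by simp
      have "node k (2 * j + 1) + pi / freq k \<le> node k (2 * i)"
      proof -
        have "node k (2 * j + 1) + pi / freq k = node k (2 * j + 2)"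
        proof -
          have "(real (2 * j + 1) + 1/2) * pi + pi = (real (2 * j + 2) + 1/2) * pi"
            by (simp add: algebra_simps)
          then show ?thesis unfolding node_def by (simp only: add_divide_distrib[symmetric])
        qed
        then show ?thesis using node_mono[of "2 * j + 2" "2 * i"] that by simp
      qed
      then have gap: "pi / freq k \<le> v i - v j" using v(1)[OF that(1)] v(2)[OF j] by linarith
      have "1 / freq k < pi / freq k"
        using pi_gt3 freq_pos[of k] by (intro divide_strict_right_mono) auto
      then have gap': "1 / freq k < v i - v j" using gap by linarith
      have "v i - v j = (sqrt (v i) - sqrt (v j)) * (sqrt (v i) + sqrt (v j))"
        using v01[OF that(1)] v01[OF j] by (simp add: algebra_simps flip: power2_eq_square)
      also have "\<dots> \<le> (sqrt (v i) - sqrt (v j)) * 2"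
      proof (rule mult_left_mono)
        show "sqrt (v i) + sqrt (v j) \<le> 2"
          using v01[OF that(1)] v01[OF j] real_sqrt_le_1_iff[of "v i"] real_sqrt_le_1_iff[of "v j"] by linarith
        have "0 < 1 / real (freq k)" using freq_pos[of k] by simp
        then have "v j \<le> v i" using gap' by linarith
        then show "0 \<le> sqrt (v i) - sqrt (v j)" by simp
      qed
      finally have "r * (1 / freq k) < r * ((sqrt (v i) - sqrt (v j)) * 2)"
        using gap' r by (intro mult_strict_left_mono) auto
      then have "\<delta> < r * sqrt (v i) - r * sqrt (v j)"
        using freq_pos[of k] by (simp add: \<delta>_def field_simps)
      also have "\<dots> = P (v i) $ 1 - P (v j) $ 1"
        using P(2)[OF v01[OF that(1)]] P(2)[OF v01[OF j]] by simp
      also have "\<dots> \<le> norm (P (v i) - P (v j))"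
        using component_le_norm_cart[of "P (v i) - P (v j)" 1] by simp
      finally show ?thesis by (simp add: dist_norm norm_minus_commute)
    qed
    show "\<exists>t :: nat \<Rightarrow> real^3. \<forall>i<16 ^ k. t i \<in> sphere 0 r \<inter> twist 1 ` xyplane \<and> t i $ 3 = y \<and>
        (\<forall>j<i. \<delta> < dist (t j) (t i))"
    proof (intro exI[of _ "\<lambda>i. P (v i)"] allI impI conjI)
      fix i :: nat assume i: "i < 16 ^ k"
      show "P (v i) \<in> sphere 0 r \<inter> twist 1 ` xyplane" by (rule P(1)[OF v01[OF i]])
      show "P (v i) $ 3 = y" using P(3)[OF v01[OF i]] v(3)[OF i] by (simp add: g_def)
      show "\<delta> < dist (P (v j)) (P (v i))" if "j < i" for j by (rule sep[OF i that])
    qed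
  qed
  also have "\<dots> \<le> hausdorff1 (sphere 0 r \<inter> twist 1 ` xyplane)"
    using \<delta> by (rule hausdorff1_pre_le_hausdorff1)
  finally have *: "ennreal (real (16 ^ k) * h) \<le> hausdorff1 (sphere 0 r \<inter> twist 1 ` xyplane)" .
  \<comment> \<open>From \<open>16 ^ k * h = r * 4 ^ k / 24\<close> and
    \<open>r >= q > (1/2) ^ Suc k\<close> the length is at least \<open>2 ^ k / 48\<close>, and
    \<open>2 ^ k > 1 / (2 * q)\<close> yields the constant 96.\<close>
  have "1 / (96 * q) \<le> real (16 ^ k) * h"
  proof -
    have "(1/2) ^ Suc k \<le> r"
    proof -
      have "r * r \<le> r * 1" using r by (intro mult_left_mono) auto
      then show ?thesis using k1 by (simp add: q_def power2_eq_square)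
    qed
    have "1 / (96 * q) \<le> 2 ^ k / 48"
      using k1 q by (simp add: power_one_over field_simps)
    also have "\<dots> = 4 ^ k * (1/2) ^ Suc k / 24"
    proof -
      have "(4::real) ^ k = 2 ^ k * 2 ^ k" by (simp flip: power_mult_distrib)
      then show ?thesis by (simp add: power_one_over)
    qed
    also have "\<dots> \<le> 4 ^ k * r / 24"
      using \<open>(1/2) ^ Suc k \<le> r\<close> by (intro divide_right_mono mult_left_mono) auto
    also have "\<dots> = real (16 ^ k) * h"
    proof -
      have "(16::real) ^ k = 4 ^ k * 4 ^ k" by (simp flip: power_mult_distrib)
      then show ?thesis by (simp add: h_def power_one_over)
    qed
    finally show ?thesis .
  qed
  then have "ennreal (1 / (96 * r\<^sup>2)) \<le> ennreal (real (16 ^ k) * h)"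
    unfolding q_def by (rule ennreal_leI)
  then show ?thesis using * by (rule order_trans)
qed

section \<open>The twisted plane is the required surface\<close>

lemma twist_punctured: "twist 1 ` xyplane - {0} = twist 1 ` (- {0} \<inter> xyplane)"
proof -
  have "inj (twist 1)" by (rule inj_on_inverseI) (rule twist_uminus_twist)
  then have "twist 1 ` (xyplane - {0}) = twist 1 ` xyplane - twist 1 ` {0}"
    by (rule image_set_diff)
  moreover have "xyplane - {0} = - {0} \<inter> xyplane" by blast
  ultimately show ?thesis by simp
qed

lemma Ck_submanifold_punctured: "Ck_submanifold \<infinity> 2 (twist 1 ` xyplane - {0})"
  unfolding twist_punctured
proof (rule Ck_submanifold_twist)
  show "open (- {0::real^3})" by (simp add: open_Compl)
  show "twist s ` (- {0}) \<subseteq> - {0}" for s by auto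
  show "Ck_on \<infinity> (- {0}) (twist s)" for s
    unfolding Ck_on_def by (intro allI impI Cn_on_twist)
qed

lemma punctured_surface_twist: "punctured_surface (twist 1 ` xyplane)"
  unfolding punctured_surface_def
proof (intro conjI)
  show "0 \<in> twist 1 ` xyplane"
    by (rule image_eqI[of _ _ 0]) (simp_all add: xyplane_def)
  have "Ck_on 0 UNIV (twist s)" for s
    using continuous_on_twist by (auto simp: Ck_on_def enat_0_iff)
  then have "Ck_submanifold 0 2 (twist 1 ` (UNIV \<inter> xyplane))"
    by (rule Ck_submanifold_twist[OF open_UNIV subset_UNIV])
  then show "Ck_submanifold 0 2 (twist 1 ` xyplane)" by simp
qed (rule Ck_submanifold_punctured)

text \<open>The exponent 1 and the constant 8 suffice. The surface is unbounded, so the quadratic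
  bound is used only for \<open>norm p <= 1\<close>; farther out a sine is at most 1.\<close>

lemma strict_whitney_twist: "strict_whitney (twist 1 ` xyplane - {0})"
  unfolding strict_whitney_def
proof (intro conjI)
  let ?M = "twist 1 ` xyplane - {0}"
  show "\<exists>d. Ck_submanifold 1 d ?M"
    using Ck_submanifold_mono[OF Ck_submanifold_punctured, of 1] by auto
  show "0 \<in> closure ?M"
    unfolding closure_approachable
  proof (intro allI impI)
    fix e :: real assume e: "e > 0"
    define p :: "real^3" where "p = (e / 2) *\<^sub>R axis 1 1"
    have "norm p = e / 2" using e by (simp add: p_def norm_axis_1)
    moreover have "p \<in> xyplane" by (simp add: p_def xyplane_def axis_def)
    ultimately have p: "p \<in> xyplane" "p \<noteq> 0" "norm p < e" using e by auto
    show "\<exists>y\<in>?M. dist y 0 < e"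
      by (rule bexI[of _ "twist 1 p"]) (use p in \<open>auto\<close>)
  qed
  have "whitney_fun ?M x 0 ^ 1 \<le> 8 * norm x" if x: "x \<in> ?M" for x
  proof -
    obtain p where p: "p \<in> xyplane" "p \<noteq> 0" "x = twist 1 p"
      using x unfolding twist_punctured by blast
    have "whitney_fun ?M x 0 \<le> 8 * (norm p)\<^sup>2"
      unfolding twist_punctured p(3)
      by (rule whitney_fun_twist_le[OF p(1,2) Ck_submanifold_punctured[unfolded twist_punctured]])
    moreover have "whitney_fun ?M x 0 \<le> 1" by (simp add: whitney_fun_def)
    moreover have "(norm p)\<^sup>2 \<le> norm p" if "norm p \<le> 1"
      using that by (simp add: power2_eq_square mult_left_le)
    moreover have "norm x = norm p" using p(3) by simp
    ultimately show ?thesis unfolding power_one_right by (cases "norm p \<le> 1"; linarith)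
  qed
  then show "\<exists>N\<ge>1. \<exists>C>0. \<forall>x\<in>?M. whitney_fun ?M x 0 ^ N \<le> C * norm x"
    by (intro exI[of _ "1::nat"] exI[of _ "8::real"] conjI ballI) simp_all
qed simp

lemma length_twist_tendsto:
  "((\<lambda>r. hausdorff1 (sphere 0 r \<inter> twist 1 ` xyplane)) \<longlongrightarrow> \<infinity>) (at_right 0)"
proof (rule tendsto_sandwich)
  have ev: "\<forall>\<^sub>F r in at_right 0. (0::real) < r \<and> r < 1"
    using eventually_at_right_real[of 0 "1::real"] by (simp only: greaterThanLessThan_iff zero_less_one)
  show "\<forall>\<^sub>F r in at_right 0. ennreal (1 / (96 * r\<^sup>2)) \<le> hausdorff1 (sphere 0 r \<inter> twist 1 ` xyplane)"
    using ev by eventually_elim (intro hausdorff1_sphere_ge, simp_all)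
  show "\<forall>\<^sub>F r in at_right 0. hausdorff1 (sphere 0 r \<inter> twist 1 ` xyplane) \<le> \<infinity>"
    by simp
  have "filterlim (\<lambda>r::real. inverse (96 * r\<^sup>2)) at_top (at_right 0)"
  proof (rule filterlim_compose[OF filterlim_inverse_at_top_right])
    have "((\<lambda>r::real. 96 * r\<^sup>2) \<longlongrightarrow> 96 * 0\<^sup>2) (at_right 0)"
      by (intro tendsto_intros)
    moreover have "\<forall>\<^sub>F r::real in at_right 0. 96 * r\<^sup>2 \<in> {0<..} \<and> 96 * r\<^sup>2 \<noteq> 0"
      using ev by eventually_elim simp
    ultimately show "filterlim (\<lambda>r::real. 96 * r\<^sup>2) (at_right 0) (at_right 0)"
      unfolding filterlim_at by simp
  qed
  then show "((\<lambda>r::real. ennreal (1 / (96 * r\<^sup>2))) \<longlongrightarrow> \<infinity>) (at_right 0)"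
    unfolding infinity_ennreal_def ennreal_tendsto_top_eq_at_top by (simp only: inverse_eq_divide)
  show "((\<lambda>r::real. \<infinity> :: ennreal) \<longlongrightarrow> \<infinity>) (at_right 0)" by (rule tendsto_const)
qed

theorem mainTheorem2:
  shows "(\<exists>S :: (real^3) set.
            punctured_surface S \<and> strict_whitney (S - {0}) \<and>
            ((\<lambda>r. hausdorff1 (sphere 0 r \<inter> S)) \<longlongrightarrow> \<infinity>) (at_right 0)) \<and>
         \<not> (\<forall>S :: (real^3) set.
              punctured_surface S \<and> strict_whitney (S - {0}) \<longrightarrow>
              (\<exists>(C::real) r0. r0 > 0 \<and>
                 (\<forall>r. 0 < r \<and> r \<le> r0 \<longrightarrow> hausdorff1 (sphere 0 r \<inter> S) \<le> ennreal (C * r))))"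
proof
  show "\<exists>S :: (real^3) set. punctured_surface S \<and> strict_whitney (S - {0}) \<and>
      ((\<lambda>r. hausdorff1 (sphere 0 r \<inter> S)) \<longlongrightarrow> \<infinity>) (at_right 0)"
    by (rule exI[of _ "twist 1 ` xyplane"])
      (intro conjI punctured_surface_twist strict_whitney_twist length_twist_tendsto)
  show "\<not> (\<forall>S :: (real^3) set. punctured_surface S \<and> strict_whitney (S - {0}) \<longrightarrow>
      (\<exists>(C::real) r0. r0 > 0 \<and>
        (\<forall>r. 0 < r \<and> r \<le> r0 \<longrightarrow> hausdorff1 (sphere 0 r \<inter> S) \<le> ennreal (C * r))))"
    (is "\<not> (\<forall>S. ?A S \<longrightarrow> ?B S)")
  proof
    assume "\<forall>S. ?A S \<longrightarrow> ?B S"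
    then have "?A (twist 1 ` xyplane) \<longrightarrow> ?B (twist 1 ` xyplane)" by (rule spec)
    then have "?B (twist 1 ` xyplane)"
      by (rule mp) (intro conjI punctured_surface_twist strict_whitney_twist)
    then obtain C r0 where r0: "r0 > 0"
      and "\<forall>r. 0 < r \<and> r \<le> r0 \<longrightarrow> hausdorff1 (sphere 0 r \<inter> twist 1 ` xyplane) \<le> ennreal (C * r)"
      by (elim exE conjE) (rule that)
    then have le: "hausdorff1 (sphere 0 r \<inter> twist 1 ` xyplane) \<le> ennreal (C * r)"
      if "0 < r" "r \<le> r0" for r
      using that by simp
    \<comment> \<open>On \<open>0 < r <= r0\<close> the linear bound is at most the constant
      \<open>\<bar>C\<bar> * r0\<close>, which the lengths eventually exceed. This is impossible
      because \<open>at_right 0\<close> is a nontrivial filter.\<close>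
    have "\<forall>\<^sub>F r in at_right 0. hausdorff1 (sphere 0 r \<inter> twist 1 ` xyplane) > ennreal (\<bar>C\<bar> * r0)"
      using length_twist_tendsto by (rule order_tendstoD) (simp add: less_top)
    moreover have "\<forall>\<^sub>F r in at_right 0. 0 < r \<and> r < r0"
      using eventually_at_right_real[of 0 r0] r0 by simp
    ultimately have "\<forall>\<^sub>F r in at_right (0::real). False"
    proof eventually_elim
      case (elim r)
      then have "C * r \<le> \<bar>C\<bar> * r0" by (intro mult_mono) auto
      then have "hausdorff1 (sphere 0 r \<inter> twist 1 ` xyplane) \<le> ennreal (\<bar>C\<bar> * r0)"
        using le[of r] elim by (intro order_trans[OF le ennreal_leI]) auto
      then show ?case using elim by (simp add: not_less[symmetric])
    qed
    then show False by simp
  qed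
qed

end
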